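(* Let $\Gamma$ be a finitely generated group and let $\nu\colon\mathbb{R}_{>0}\times\mathbb{N}\to\mathbb{N}\cup\{0,\infty\}$ be monotone non-decreasing in the first argument. If every invariant random subgroup of $\Gamma$ is co-sofic, then $\Gamma$ is BS-rigid (resp. $\nu$-flexibly BS-rigid) if and only if $\Gamma$ is stable (resp. $\nu$-flexibly stable).
   Context: Invariant random subgroups: $\mathrm{Sub}(\Gamma)$ is the space of subgroups of $\Gamma$ with the topology induced from the product topology on $\{0,1\}^\Gamma$. An invariant random subgroup of $\Gamma$ is a Borel regular probability measure on $\mathrm{Sub}(\Gamma)$ invariant under conjugation by $\Gamma$; the space $\mathrm{IRS}(\Gamma)$ of these has the weak-$*$ topology. An invariant random subgroup is co-sofic if it is a weak-$*$ limit of a sequence of invariant random subgroups of $\Gamma$ supported on finite-index subgroups. Write $[n]=\{1,\dots,n\}$ and $\mathrm{Sym}(n)$ for the symmetric group on $[n]$. For $\sigma\in\mathrm{Sym}(n)$ and $\tau\in\mathrm{Sym}(M)$ with $M\ge n$, $d(\sigma,\tau)=d(\tau,\sigma)=\frac1n|\{x\in[n]\mid\sigma x\neq\tau x\}|$. For $f\colon\Gamma\to\mathrm{Sym}(n)$ and finite $Q\subset\Gamma$, $N_{f,Q}$ is the distribution on $2^Q$ of $\{\gamma\in Q\mid f(\gamma)x=x\}$ with $x$ uniform in $[n]$; $d_{\mathrm{TV}}$ is total variation distance (half the $\ell^1$ distance). Call a sequence of functions $(f_\ell\colon\Gamma\to\mathrm{Sym}(n_\ell))_{\ell=1}^\infty$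 with $n_\ell\to\infty$ an asymptotic homomorphism if $d(f_\ell(\gamma_1\gamma_2),f_\ell(\gamma_1)f_\ell(\gamma_2))\to0$ for all $\gamma_1,\gamma_2\in\Gamma$. Call it $\nu$-correctable if there are positive reals $\varepsilon_\ell\to0$ and homomorphisms $(h_\ell\colon\Gamma\to\mathrm{Sym}(N_\ell))_{\ell=1}^\infty$ with $n_\ell\le N_\ell\le n_\ell+\nu(\varepsilon_\ell,n_\ell)$ such that $d(f_\ell(\gamma),h_\ell(\gamma))\to0$ for all $\gamma\in\Gamma$. A group $\Gamma$ is $\nu$-flexibly stable if every asymptotic homomorphism is $\nu$-correctable. It is $\nu$-flexibly BS-rigid if every asymptotic homomorphism $(f_\ell)$ for which there exist homomorphisms $(g_\ell\colon\Gamma\to\mathrm{Sym}(n_\ell))_{\ell=1}^\infty$ with $d_{\mathrm{TV}}(N_{f_\ell,Q},N_{g_\ell,Q})\to0$ for every finite $Q\subset\Gamma$ is $\nu$-correctable. Stable and BS-rigid mean the respective notions with $\nu=0$. *)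

theory Defs
  imports "HOL-Algebra.Sym_Groups" "HOL-Probability.Probability"
begin

definition finitely_generated_group :: "('a, 'b) monoid_scheme \<Rightarrow> bool" where
  "finitely_generated_group G \<longleftrightarrow>
     group G \<and> (\<exists>S. finite S \<and> S \<subseteq> carrier G \<and> generate G S = carrier G)"


section \<open>Invariant random subgroups\<close>

text \<open>The subspace topology on the subgroups, each identified with its indicator function in
  the product of copies of the two-point discrete space indexed by the carrier.\<close>

definition Sub_topology :: "('a, 'b) monoid_scheme \<Rightarrow> 'a set topology" where
  "Sub_topology G = pullback_topology {H. subgroup H G} (\<lambda>H. \<lambda>x\<in>carrier G. x \<in> H)
     (product_topology (\<lambda>_. discrete_topology (UNIV :: bool set)) (carrier G))"

definition Sub_borel :: "('a, 'b) monoid_scheme \<Rightarrow> 'a set measure" where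
  "Sub_borel G = sigma {H. subgroup H G} {U. openin (Sub_topology G) U}"

definition regular_measure :: "'c topology \<Rightarrow> 'c measure \<Rightarrow> bool" where
  "regular_measure T \<mu> \<longleftrightarrow> (\<forall>A\<in>sets \<mu>.
     emeasure \<mu> A = (SUP K\<in>{K. compactin T K \<and> K \<in> sets \<mu> \<and> K \<subseteq> A}. emeasure \<mu> K) \<and>
     emeasure \<mu> A = (INF U\<in>{U. openin T U \<and> U \<in> sets \<mu> \<and> A \<subseteq> U}. emeasure \<mu> U))"

definition conj_subgroup :: "('a, 'b) monoid_scheme \<Rightarrow> 'a \<Rightarrow> 'a set \<Rightarrow> 'a set" where
  "conj_subgroup G g H = (g <#\<^bsub>G\<^esub> H) #>\<^bsub>G\<^esub> (inv\<^bsub>G\<^esub> g)"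

definition IRS :: "('a, 'b) monoid_scheme \<Rightarrow> 'a set measure set" where
  "IRS G = {\<mu>. prob_space \<mu> \<and> sets \<mu> = sets (Sub_borel G) \<and>
     regular_measure (Sub_topology G) \<mu> \<and>
     (\<forall>g\<in>carrier G. distr \<mu> (Sub_borel G) (conj_subgroup G g) = \<mu>)}"

text \<open>The weak-* topology is the coarsest one for which integration against every continuous
  real function on the (compact) space of subgroups is continuous.\<close>

definition IRS_topology :: "('a, 'b) monoid_scheme \<Rightarrow> 'a set measure topology" where
  "IRS_topology G =
     pullback_topology (IRS G)
       (\<lambda>\<mu>. \<lambda>\<phi>\<in>{\<phi>. continuous_map (Sub_topology G) euclideanreal \<phi>}. integral\<^sup>L \<mu> \<phi>)
       (product_topology (\<lambda>_. euclideanreal)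
          {\<phi>. continuous_map (Sub_topology G) euclideanreal \<phi>})"

definition co_sofic :: "('a, 'b) monoid_scheme \<Rightarrow> 'a set measure \<Rightarrow> bool" where
  "co_sofic G \<mu> \<longleftrightarrow> (\<exists>m :: nat \<Rightarrow> 'a set measure.
     (\<forall>k. m k \<in> IRS G \<and> (AE H in m k. finite (rcosets\<^bsub>G\<^esub> H))) \<and>
     limitin (IRS_topology G) m \<mu> sequentially)"

lemma topspace_Sub_topology [simp]: "topspace (Sub_topology G) = {H. subgroup H G}"
  by (auto simp: Sub_topology_def topspace_pullback_topology)

lemma open_Sub_subset: "{U. openin (Sub_topology G) U} \<subseteq> Pow {H. subgroup H G}"
  using openin_subset topspace_Sub_topology by blast

lemma space_Sub_borel [simp]: "space (Sub_borel G) = {H. subgroup H G}"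
  unfolding Sub_borel_def by (rule space_measure_of[OF open_Sub_subset])

lemma sets_Sub_borel:
  "sets (Sub_borel G) = sigma_sets {H. subgroup H G} {U. openin (Sub_topology G) U}"
  unfolding Sub_borel_def by (rule sets_measure_of[OF open_Sub_subset])

lemma topspace_IRS_topology [simp]: "topspace (IRS_topology G) = IRS G"
  by (auto simp: IRS_topology_def topspace_pullback_topology)

lemma limitin_pullback_topology:
  assumes "f ` A \<subseteq> topspace T"
  shows "limitin (pullback_topology A f T) u l F \<longleftrightarrow>
    l \<in> A \<and> (\<forall>\<^sub>F k in F. u k \<in> A) \<and> limitin T (\<lambda>k. f (u k)) (f l) F"
  (is "?L \<longleftrightarrow> ?R")
proof
  assume L: ?L
  then have l: "l \<in> A"
    by (auto simp: limitin_def topspace_pullback_topology)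
  have ev: "\<forall>\<^sub>F k in F. u k \<in> f -` U \<inter> A" if "openin T U" "f l \<in> U" for U
  proof -
    have "openin (pullback_topology A f T) (f -` U \<inter> A)" "l \<in> f -` U \<inter> A"
      using that l by (auto simp: openin_pullback_topology)
    with L show ?thesis unfolding limitin_def by blast
  qed
  have "\<forall>\<^sub>F k in F. u k \<in> A"
    by (rule eventually_mono[OF ev[of "topspace T"]]) (use l assms in auto)
  moreover have "\<forall>\<^sub>F k in F. f (u k) \<in> U" if "openin T U" "f l \<in> U" for U
    by (rule eventually_mono[OF ev[OF that]]) auto
  ultimately show ?R using l assms by (auto simp: limitin_def)
next
  assume R: ?R
  have "\<forall>\<^sub>F k in F. u k \<in> f -` U \<inter> A" if "openin T U" "l \<in> f -` U" for U
  proof -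
    have "\<forall>\<^sub>F k in F. f (u k) \<in> U"
      using R that by (auto simp: limitin_def)
    moreover have "\<forall>\<^sub>F k in F. u k \<in> A" using R by blast
    ultimately show ?thesis by eventually_elim auto
  qed
  moreover have "l \<in> topspace (pullback_topology A f T)"
    using R assms by (auto simp: topspace_pullback_topology)
  ultimately show ?L
    unfolding limitin_def openin_pullback_topology by blast
qed

lemma limitin_IRS_topology:
  assumes "\<And>k. m k \<in> IRS G"
  shows "limitin (IRS_topology G) m \<mu> sequentially \<longleftrightarrow> \<mu> \<in> IRS G \<and>
    (\<forall>\<phi>. continuous_map (Sub_topology G) euclideanreal \<phi> \<longrightarrow>
      (\<lambda>k. integral\<^sup>L (m k) \<phi>) \<longlonglongrightarrow> integral\<^sup>L \<mu> \<phi>)"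
  unfolding IRS_topology_def
  by (subst limitin_pullback_topology) (auto simp: limitin_componentwise assms split: if_split_asm)


section \<open>Asymptotic homomorphisms to symmetric groups\<close>

text \<open>The normalised Hamming distance of permutations whose degrees have minimum \<open>n\<close>.\<close>

definition perm_dist :: "nat \<Rightarrow> (nat \<Rightarrow> nat) \<Rightarrow> (nat \<Rightarrow> nat) \<Rightarrow> real" where
  "perm_dist n \<sigma> \<tau> = real (card {x \<in> {1..n}. \<sigma> x \<noteq> \<tau> x}) / real n"

definition stab_dist :: "nat \<Rightarrow> ('a \<Rightarrow> nat \<Rightarrow> nat) \<Rightarrow> 'a set \<Rightarrow> 'a set pmf" where
  "stab_dist n f Q = map_pmf (\<lambda>x. {\<gamma> \<in> Q. f \<gamma> x = x}) (pmf_of_set {1..n})"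

definition tv_dist :: "'c set \<Rightarrow> 'c pmf \<Rightarrow> 'c pmf \<Rightarrow> real" where
  "tv_dist X p q = (\<Sum>a\<in>X. \<bar>pmf p a - pmf q a\<bar>) / 2"

definition asymptotic_hom ::
    "('a, 'b) monoid_scheme \<Rightarrow> (nat \<Rightarrow> nat) \<Rightarrow> (nat \<Rightarrow> 'a \<Rightarrow> nat \<Rightarrow> nat) \<Rightarrow> bool" where
  "asymptotic_hom G n f \<longleftrightarrow>
     (\<forall>l. n l \<ge> 1) \<and> filterlim n at_top sequentially \<and>
     (\<forall>l. f l \<in> carrier G \<rightarrow> carrier (sym_group (n l))) \<and>
     (\<forall>\<gamma>\<^sub>1\<in>carrier G. \<forall>\<gamma>\<^sub>2\<in>carrier G.
        (\<lambda>l. perm_dist (n l) (f l (\<gamma>\<^sub>1 \<otimes>\<^bsub>G\<^esub> \<gamma>\<^sub>2)) (f l \<gamma>\<^sub>1 \<otimes>\<^bsub>sym_group (n l)\<^esub> f l \<gamma>\<^sub>2))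
          \<longlonglongrightarrow> 0)"

text \<open>Only the values \<open>\<nu> \<epsilon> n\<close> with \<open>\<epsilon> > 0\<close> and \<open>n \<ge> 1\<close> are ever used.\<close>

definition correctable ::
    "(real \<Rightarrow> nat \<Rightarrow> enat) \<Rightarrow> ('a, 'b) monoid_scheme \<Rightarrow> (nat \<Rightarrow> nat)
       \<Rightarrow> (nat \<Rightarrow> 'a \<Rightarrow> nat \<Rightarrow> nat) \<Rightarrow> bool" where
  "correctable \<nu> G n f \<longleftrightarrow> (\<exists>(\<epsilon> :: nat \<Rightarrow> real) (N :: nat \<Rightarrow> nat) h.
     (\<forall>l. \<epsilon> l > 0) \<and> \<epsilon> \<longlonglongrightarrow> 0 \<and>
     (\<forall>l. h l \<in> hom G (sym_group (N l))) \<and>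
     (\<forall>l. n l \<le> N l \<and> enat (N l) \<le> enat (n l) + \<nu> (\<epsilon> l) (n l)) \<and>
     (\<forall>\<gamma>\<in>carrier G. (\<lambda>l. perm_dist (n l) (f l \<gamma>) (h l \<gamma>)) \<longlonglongrightarrow> 0))"

definition flexibly_stable :: "(real \<Rightarrow> nat \<Rightarrow> enat) \<Rightarrow> ('a, 'b) monoid_scheme \<Rightarrow> bool" where
  "flexibly_stable \<nu> G \<longleftrightarrow> (\<forall>n f. asymptotic_hom G n f \<longrightarrow> correctable \<nu> G n f)"

definition flexibly_BS_rigid :: "(real \<Rightarrow> nat \<Rightarrow> enat) \<Rightarrow> ('a, 'b) monoid_scheme \<Rightarrow> bool" where
  "flexibly_BS_rigid \<nu> G \<longleftrightarrow> (\<forall>n f. asymptotic_hom G n f \<longrightarrow>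
     (\<exists>g. (\<forall>l. g l \<in> hom G (sym_group (n l))) \<and>
        (\<forall>Q. finite Q \<and> Q \<subseteq> carrier G \<longrightarrow>
          (\<lambda>l. tv_dist (Pow Q) (stab_dist (n l) (f l) Q) (stab_dist (n l) (g l) Q)) \<longlonglongrightarrow> 0)) \<longrightarrow>
     correctable \<nu> G n f)"

definition stable :: "('a, 'b) monoid_scheme \<Rightarrow> bool" where
  "stable G \<longleftrightarrow> flexibly_stable (\<lambda>_ _. 0) G"

definition BS_rigid :: "('a, 'b) monoid_scheme \<Rightarrow> bool" where
  "BS_rigid G \<longleftrightarrow> flexibly_BS_rigid (\<lambda>_ _. 0) G"

end

theory Submission
  imports Defs
begin

text \<open>
  Stability trivially implies BS-rigidity. Conversely it suffices to show that the local statistics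
  of any asymptotic homomorphism \<open>f\<close> are asymptotically those of genuine actions on the same finite
  sets. Otherwise some subsequence stays at positive distance from all actions. Its stabiliser
  distributions have a weak limit along a further subsequence; almost multiplicativity of \<open>f\<close>
  makes the limit a conjugation invariant measure on subgroups. As this invariant random subgroup is
  co-sofic, it is close to one supported on finite-index subgroups. Since \<open>\<Gamma>\<close> is finitely generated,
  all but a small part of the latter lives on finitely many subgroups \<open>H\<close>, and it is realised
  approximately on any large finite set by suitably many copies of the coset actions on
  \<open>\<Gamma> / H\<close>, a contradiction.

  Compactness is obtained from Helly's theorem: a subset of \<open>\<Gamma>\<close> is encoded by a point of a Cantor set,
  whose ternary digits extend to continuous functions on the real line.
\<close>

section \<open>Encoding sets of natural numbers by reals\<close>

text \<open>For a fixed l the elements that \<open>f l\<close> lets fix a point need not form a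
  subgroup, so the stabiliser laws do not live on the space of subgroups. They are taken as laws of
  codes of arbitrary subsets, and their weak limit on the real line might a priori charge reals that
  code nothing. Continuous tests settle both issues: the tests for a fractional digit and for each
  violated subgroup axiom have integral zero in the limit, and countability of the carrier lets them
  all vanish almost everywhere at once. The code is a homeomorphism onto its image, so Borel sets
  and regularity are transferred from the real line as well. Total variation is replaced until the
  end by frequencies of cylinders (some elements must fix, others must move), which is what weak
  convergence sees. Finite generation gives countability and finiteness of the set of subgroups of
  index at most k. That set is closed under conjugation, which is why coset actions reproduce the
  truncated measure exactly. Rigidity wants one sequence of actions serving all finite Q, hence a
  diagonal choice at the end.\<close>

text \<open>Base 3 with digits 0 and 1 leaves gaps between codes, so the digits extend continuously
  to the line. In base 2 two sets could share a code.\<close>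

definition code_real :: "nat set \<Rightarrow> real" where
  "code_real A = (\<Sum>i. of_bool (i \<in> A) * (1/3)^i)"

text \<open>Codes of sets without 0 are at most 1/2, codes of sets with 0 are at least 1. This
  interpolates linearly across the gap.\<close>

definition ramp :: "real \<Rightarrow> real" where
  "ramp y = min 1 (max 0 (2 * y - 1))"

text \<open>The ternary shift: remove the leading digit and multiply by 3. Writing the digit as
  \<open>ramp\<close> keeps the shift continuous on the whole line.\<close>

primrec residue_real :: "nat \<Rightarrow> real \<Rightarrow> real" where
  "residue_real 0 x = x"
| "residue_real (Suc i) x = 3 * (residue_real i x - ramp (residue_real i x))"

definition digit :: "nat \<Rightarrow> real \<Rightarrow> real" where
  "digit i x = ramp (residue_real i x)"

lemma summable_code_real: "summable (\<lambda>i. of_bool (i \<in> A) * (1/3)^i :: real)"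
  by (rule summable_comparison_test'[of "\<lambda>i. (1/3::real)^i" 0]) (auto intro: summable_geometric)

lemma code_real_nonneg: "0 \<le> code_real A"
  unfolding code_real_def by (intro suminf_nonneg summable_code_real) auto

lemma code_real_le: "code_real A \<le> 3/2"
proof -
  have "code_real A \<le> (\<Sum>i. (1/3::real)^i)"
    unfolding code_real_def
    by (intro suminf_le summable_code_real) (auto intro: summable_geometric)
  then show ?thesis by (simp add: suminf_geometric)
qed

lemma code_real_split: "code_real A = of_bool (0 \<in> A) + code_real {j. Suc j \<in> A} / 3"
  unfolding code_real_def
  using suminf_split_head[OF summable_code_real[of A]]
    suminf_mult[OF summable_code_real[of "{j. Suc j \<in> A}"], of "1/3"]
  by (simp add: algebra_simps)

lemma code_real_tail: "code_real A = (\<Sum>i<n. of_bool (i \<in> A) * (1/3)^i) + (1/3)^n * code_real {j. n + j \<in> A}"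
proof -
  have "(\<lambda>i. of_bool (i + n \<in> A) * (1/3)^(i + n) :: real) = (\<lambda>i. (1/3)^n * (of_bool (n + i \<in> A) * (1/3)^i))"
    by (auto simp: power_add add.commute)
  then show ?thesis
    unfolding code_real_def
    using suminf_split_initial_segment[OF summable_code_real[of A], of n]
      suminf_mult[OF summable_code_real[of "{j. n + j \<in> A}"], of "(1/3)^n"]
    by simp
qed

lemma ramp_code_real: "ramp (code_real A) = of_bool (0 \<in> A)"
  using code_real_split[of A] code_real_nonneg[of "{j. Suc j \<in> A}"]
    code_real_le[of "{j. Suc j \<in> A}"]
  by (auto simp: ramp_def)

lemma residue_code_real: "residue_real i (code_real A) = code_real {j. i + j \<in> A}"
proof (induction i)
  case (Suc i)
  show ?case
    using code_real_split[of "{j. i + j \<in> A}"] ramp_code_real[of "{j. i + j \<in> A}"]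
    by (simp add: Suc)
qed simp

lemma digit_code_real [simp]: "digit i (code_real A) = of_bool (i \<in> A)"
  by (simp add: digit_def residue_code_real ramp_code_real)

lemma digit_bounds: "0 \<le> digit i x" "digit i x \<le> 1"
  by (auto simp: digit_def ramp_def)

lemma isCont_ramp: "isCont ramp y"
  unfolding ramp_def by (intro continuous_intros)

lemma isCont_residue_real: "isCont (residue_real i) x"
proof (induction i)
  case (Suc i)
  have "isCont (\<lambda>x. ramp (residue_real i x)) x"
    using isCont_o2[OF Suc isCont_ramp] .
  with Suc show ?case by (auto intro!: continuous_intros)
qed simp

lemma isCont_digit: "isCont (digit i) x"
  unfolding digit_def using isCont_o2[OF isCont_residue_real isCont_ramp] .

lemma borel_measurable_digit [measurable]: "digit i \<in> borel_measurable borel"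
  by (intro borel_measurable_continuous_onI continuous_at_imp_continuous_on ballI isCont_digit)

text \<open>By continuity of the digits, weak limits of laws of codes are controlled by finitely many
  digits at a time.\<close>

definition digit_test :: "('a \<Rightarrow> nat) \<Rightarrow> 'a set \<Rightarrow> 'a set \<Rightarrow> real \<Rightarrow> real" where
  "digit_test e A B x = (\<Prod>a\<in>A. digit (e a) x) * (\<Prod>b\<in>B. 1 - digit (e b) x)"

lemma digit_test_bounds: "0 \<le> digit_test e A B x" "digit_test e A B x \<le> 1"
proof -
  have "0 \<le> (\<Prod>a\<in>A. digit (e a) x)" "(\<Prod>a\<in>A. digit (e a) x) \<le> 1"
    by (auto intro!: prod_nonneg prod_le_1 simp: digit_bounds)
  moreover have "0 \<le> (\<Prod>b\<in>B. 1 - digit (e b) x)" "(\<Prod>b\<in>B. 1 - digit (e b) x) \<le> 1"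
    by (auto intro!: prod_nonneg prod_le_1 simp: digit_bounds)
  ultimately show "0 \<le> digit_test e A B x" "digit_test e A B x \<le> 1"
    unfolding digit_test_def by (auto intro: mult_le_one)
qed

lemma isCont_digit_test: "isCont (digit_test e A B) x"
  unfolding digit_test_def by (intro continuous_intros isCont_digit)

lemma borel_measurable_digit_test [measurable]: "digit_test e A B \<in> borel_measurable borel"
  unfolding digit_test_def by measurable

lemma digit_test_of_bool:
  assumes "finite A" "finite B" "\<And>a. a \<in> A \<union> B \<Longrightarrow> digit (e a) x = of_bool (P a)"
  shows "digit_test e A B x = of_bool ((\<forall>a\<in>A. P a) \<and> (\<forall>b\<in>B. \<not> P b))"
proof -
  have "(\<Prod>a\<in>A. digit (e a) x) = (\<Prod>a\<in>A. of_bool (P a))"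
       "(\<Prod>b\<in>B. 1 - digit (e b) x) = (\<Prod>b\<in>B. of_bool (\<not> P b))"
    using assms(3) by (auto intro!: prod.cong)
  moreover have "(\<Prod>a\<in>A. of_bool (P a)) = (of_bool (\<forall>a\<in>A. P a) :: real)"
    using assms(1) by (induction rule: finite_induct) auto
  moreover have "(\<Prod>b\<in>B. of_bool (\<not> P b)) = (of_bool (\<forall>b\<in>B. \<not> P b) :: real)"
    using assms(2) by (induction rule: finite_induct) auto
  ultimately show ?thesis unfolding digit_test_def by auto
qed


section \<open>Borel measures on the space of subgroups\<close>

locale countable_group = group G for G (structure) +
  assumes countable_carrier: "countable (carrier G)"
begin

abbreviation idx :: "'a \<Rightarrow> nat" where
  "idx \<equiv> to_nat_on (carrier G)"

definition code :: "'a set \<Rightarrow> real" where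
  "code H = code_real (idx ` H)"

text \<open>Away from codes a digit may be fractional. Only the value 1 counts as membership, so
  every real decodes to some subset.\<close>

definition decode :: "real \<Rightarrow> 'a set" where
  "decode x = {g \<in> carrier G. digit (idx g) x = 1}"

lemma idx_mem_iff: "H \<subseteq> carrier G \<Longrightarrow> g \<in> carrier G \<Longrightarrow> idx g \<in> idx ` H \<longleftrightarrow> g \<in> H"
  using inj_on_to_nat_on[OF countable_carrier] by (auto dest: inj_onD)

lemma digit_code: "H \<subseteq> carrier G \<Longrightarrow> g \<in> carrier G \<Longrightarrow> digit (idx g) (code H) = of_bool (g \<in> H)"
  by (simp add: code_def idx_mem_iff)

lemma decode_code: "H \<subseteq> carrier G \<Longrightarrow> decode (code H) = H"
  by (auto simp: decode_def digit_code subsetD)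

lemma decode_subset: "decode x \<subseteq> carrier G"
  by (auto simp: decode_def)

lemma continuous_map_member:
  assumes "g \<in> carrier G"
  shows "continuous_map (Sub_topology G) euclideanreal (\<lambda>H. of_bool (g \<in> H))"
proof -
  have "continuous_map (product_topology (\<lambda>_. discrete_topology (UNIV :: bool set)) (carrier G))
      euclideanreal ((\<lambda>b. of_bool b) \<circ> (\<lambda>f. f g))"
    by (rule continuous_map_compose[OF continuous_map_product_projection[OF assms]]) simp
  from continuous_map_pullback[OF this, of "{H. subgroup H G}" "\<lambda>H. \<lambda>x\<in>carrier G. x \<in> H"] assms
  show ?thesis unfolding Sub_topology_def by (simp add: o_def)
qed

text \<open>The partial sums depend on finitely many memberships and are continuous; the ternary
  tail is at most \<open>(1/3)^n * (3/2)\<close> for every subgroup, so the limit is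
  uniform.\<close>

lemma continuous_map_code: "continuous_map (Sub_topology G) euclideanreal code"
proof -
  have digit_cont: "continuous_map (Sub_topology G) euclideanreal (\<lambda>H. of_bool (i \<in> idx ` H))" for i
  proof (cases "i \<in> idx ` carrier G")
    case True
    then obtain g where g: "g \<in> carrier G" "i = idx g" by auto
    show ?thesis
      by (rule continuous_map_eq[OF continuous_map_member[OF g(1)]])
         (auto simp: g(2) idx_mem_iff[OF subgroup.subset g(1)])
  next
    case False
    have "continuous_map (Sub_topology G) euclideanreal (\<lambda>H. 0)" by simp
    then show ?thesis
      by (rule continuous_map_eq) (use False in \<open>auto dest: subgroup.subset\<close>)
  qed
  have "continuous_map (Sub_topology G) Met_TC.mtopology code"
  proof (rule Met_TC.continuous_map_uniform_limit[where F = sequentially])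
    show "\<forall>\<^sub>F n in sequentially. continuous_map (Sub_topology G) Met_TC.mtopology
        (\<lambda>H. \<Sum>i<n. of_bool (i \<in> idx ` H) * (1/3::real)^i)"
      unfolding mtopology_is_euclidean
      by (intro always_eventually allI continuous_map_sum continuous_map_real_mult digit_cont) auto
    fix \<epsilon> :: real assume "\<epsilon> > 0"
    have "(\<lambda>n. (1/3::real)^n * (3/2)) \<longlonglongrightarrow> 0 * (3/2)"
      by (intro tendsto_intros LIMSEQ_power_zero) simp
    then have "\<forall>\<^sub>F n in sequentially. (1/3::real)^n * (3/2) < \<epsilon>"
      using \<open>\<epsilon> > 0\<close> by (intro order_tendstoD(2)[of _ "0 * (3/2)"]) simp_all
    then show "\<forall>\<^sub>F n in sequentially. \<forall>H\<in>topspace (Sub_topology G). code H \<in> UNIV \<and>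
        dist (\<Sum>i<n. of_bool (i \<in> idx ` H) * (1/3)^i) (code H) < \<epsilon>"
    proof eventually_elim
      case (elim n)
      have "dist (\<Sum>i<n. of_bool (i \<in> idx ` H) * (1/3)^i) (code H)
          = (1/3)^n * code_real {j. n + j \<in> idx ` H}" for H
        unfolding code_def by (subst code_real_tail[of _ n]) (simp add: dist_real_def code_real_nonneg)
      also have "\<dots> H \<le> (1/3)^n * (3/2)" for H
        by (intro mult_left_mono code_real_le) auto
      finally have "dist (\<Sum>i<n. of_bool (i \<in> idx ` H) * (1/3)^i) (code H) < \<epsilon>" for H
        using elim by (rule le_less_trans)
      then show ?case by blast
    qed
  qed simp
  then show ?thesis by simp
qed

text \<open>Converse to continuity of \<open>code\<close>: digits are continuous in the code and
  recover each membership, so the topology pulled back along \<open>code\<close> is already as fine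
  as the product topology.\<close>

lemma openin_Sub_topology_code:
  assumes "openin (Sub_topology G) U"
  obtains V where "open V" "U = {H. subgroup H G \<and> code H \<in> V}"
proof -
  let ?S = "{H. subgroup H G}"
  let ?T = "pullback_topology ?S code euclideanreal"
  have "continuous_map ?T (discrete_topology UNIV) (\<lambda>H. g \<in> H)" if g: "g \<in> carrier G" for g
    unfolding continuous_map_def
  proof (intro conjI allI impI)
    fix U :: "bool set"
    \<comment> \<open>An open set of reals that contains 1 or 0 exactly when \<open>U\<close>
      contains the corresponding truth value; 1/2 merely separates the two.\<close>
    define W :: "real set" where
      "W = (if True \<in> U then {1/2<..} else {}) \<union> (if False \<in> U then {..<1/2} else {})"
    have W: "of_bool b \<in> W \<longleftrightarrow> b \<in> U" for b
      by (cases b) (auto simp: W_def)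
    have "open W" by (auto simp: W_def)
    then have "open (digit (idx g) -` W)"
      by (intro continuous_open_vimage isCont_digit) auto
    moreover have "{H \<in> topspace ?T. (g \<in> H) \<in> U} = code -` (digit (idx g) -` W) \<inter> ?S"
      using g by (auto simp: topspace_pullback_topology W digit_code[OF subgroup.subset])
    ultimately show "openin ?T {H \<in> topspace ?T. (g \<in> H) \<in> U}"
      unfolding openin_pullback_topology by (auto simp: open_openin[symmetric])
  qed auto
  then have "continuous_map ?T (product_topology (\<lambda>_. discrete_topology (UNIV :: bool set)) (carrier G))
      ((\<lambda>H. \<lambda>x\<in>carrier G. x \<in> H) \<circ> id)"
    by (auto simp: continuous_map_componentwise o_def)
  then have "continuous_map ?T (Sub_topology G) id"
    unfolding Sub_topology_def
    by (intro continuous_map_pullback') (auto simp: topspace_pullback_topology)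
  then have "openin ?T {H \<in> topspace ?T. id H \<in> U}"
    using assms by (rule openin_continuous_map_preimage)
  then obtain V where "open V" "{H \<in> topspace ?T. id H \<in> U} = code -` V \<inter> ?S"
    unfolding openin_pullback_topology by (auto simp: open_openin[symmetric])
  moreover have "U \<subseteq> ?S" using openin_subset[OF assms] by simp
  ultimately have "U = {H. subgroup H G \<and> code H \<in> V}"
    by (auto simp: topspace_pullback_topology set_eq_iff)
  with \<open>open V\<close> show ?thesis by (rule that)
qed

lemma openin_code_vimage: "open V \<Longrightarrow> openin (Sub_topology G) {H. subgroup H G \<and> code H \<in> V}"
  using openin_continuous_map_preimage[OF continuous_map_code, of V] by (simp add: open_openin[symmetric])

lemma measurable_code [measurable]: "code \<in> borel_measurable (Sub_borel G)"
proof (rule borel_measurableI)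
  fix V :: "real set" assume "open V"
  have "code -` V \<inter> space (Sub_borel G) = {H. subgroup H G \<and> code H \<in> V}" by auto
  then show "code -` V \<inter> space (Sub_borel G) \<in> sets (Sub_borel G)"
    using openin_code_vimage[OF \<open>open V\<close>] by (auto simp: sets_Sub_borel)
qed

lemma sets_Sub_borel_code: "sets (Sub_borel G) = {code -` B \<inter> {H. subgroup H G} | B. B \<in> sets borel}"
proof -
  have "sets (Sub_borel G) \<subseteq> sets (vimage_algebra {H. subgroup H G} code borel)"
  proof -
    have "{U. openin (Sub_topology G) U} \<subseteq> sets (vimage_algebra {H. subgroup H G} code borel)"
    proof
      fix U assume "U \<in> {U. openin (Sub_topology G) U}"
      then obtain V where V: "open V" "U = {H. subgroup H G \<and> code H \<in> V}"
        by (auto elim: openin_Sub_topology_code)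
      have "code -` V \<inter> {H. subgroup H G} \<in> sets (vimage_algebra {H. subgroup H G} code borel)"
        using V(1) by (intro in_vimage_algebra) auto
      also have "code -` V \<inter> {H. subgroup H G} = U" using V(2) by blast
      finally show "U \<in> sets (vimage_algebra {H. subgroup H G} code borel)" .
    qed
    then show ?thesis
      using sets.sigma_sets_subset[of _ "vimage_algebra {H. subgroup H G} code borel"]
      unfolding sets_Sub_borel space_vimage_algebra by blast
  qed
  then show ?thesis
    using measurable_sets[OF measurable_code] by (auto simp: sets_vimage_algebra2)
qed

text \<open>Borel sets are pulled back along \<open>code\<close>, and \<open>code\<close> is a
  countable sum of membership indicators. Hence measurability may be checked one group element at a
  time.\<close>

lemma measurable_SubI:
  assumes "\<And>x. x \<in> space N \<Longrightarrow> subgroup (f x) G"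
    and "\<And>g. g \<in> carrier G \<Longrightarrow> {x \<in> space N. g \<in> f x} \<in> sets N"
  shows "f \<in> measurable N (Sub_borel G)"
proof -
  have "(\<lambda>x. of_bool (i \<in> idx ` f x) :: real) \<in> borel_measurable N" for i
  proof (cases "i \<in> idx ` carrier G")
    case True
    then obtain g where g: "g \<in> carrier G" "i = idx g" by auto
    have "(\<lambda>x. if g \<in> f x then 1 else 0 :: real) \<in> borel_measurable N"
      using assms(2)[OF g(1)] by (intro measurable_If measurable_const) auto
    then show ?thesis
      by (rule measurable_cong[THEN iffD1, rotated])
         (auto simp: g(2) idx_mem_iff[OF subgroup.subset[OF assms(1)] g(1)])
  next
    case False
    have "(\<lambda>x. 0 :: real) \<in> borel_measurable N" by simp
    then show ?thesis
      by (rule measurable_cong[THEN iffD1, rotated]) (use False assms(1) in \<open>auto dest: subgroup.subset\<close>)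
  qed
  then have code_f: "(\<lambda>x. code (f x)) \<in> borel_measurable N"
    unfolding code_def code_real_def by (intro borel_measurable_suminf borel_measurable_times) auto
  show ?thesis
  proof (rule measurableI)
    fix A assume "A \<in> sets (Sub_borel G)"
    then obtain B where "B \<in> sets borel" "A = code -` B \<inter> {H. subgroup H G}"
      unfolding sets_Sub_borel_code by auto
    moreover from this have "f -` A \<inter> space N = (\<lambda>x. code (f x)) -` B \<inter> space N"
      using assms(1) by auto
    ultimately show "f -` A \<inter> space N \<in> sets N"
      using measurable_sets[OF code_f] by simp
  qed (use assms(1) in auto)
qed

text \<open>The basic clopen sets. The two arguments match those of \<open>digit_test\<close>, which
  takes the value 1 on codes of members and 0 on codes of other subgroups when both sets are finite
  subsets of the carrier.\<close>

definition cylinder :: "'a set \<Rightarrow> 'a set \<Rightarrow> 'a set set" where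
  "cylinder A B = {H. subgroup H G \<and> A \<subseteq> H \<and> B \<inter> H = {}}"

lemma sets_member: "g \<in> carrier G \<Longrightarrow> {H. subgroup H G \<and> g \<in> H} \<in> sets (Sub_borel G)"
proof -
  assume g: "g \<in> carrier G"
  have "{H \<in> space (Sub_borel G). digit (idx g) (code H) = 1} \<in> sets (Sub_borel G)" by measurable
  also have "{H \<in> space (Sub_borel G). digit (idx g) (code H) = 1} = {H. subgroup H G \<and> g \<in> H}"
    using g by (auto simp: digit_code[OF subgroup.subset])
  finally show ?thesis .
qed

lemma sets_cylinder:
  assumes "finite A" "finite B" "A \<subseteq> carrier G" "B \<subseteq> carrier G"
  shows "cylinder A B \<in> sets (Sub_borel G)"
proof -
  have "(\<Inter>a\<in>A. {H. subgroup H G \<and> a \<in> H}) \<inter> space (Sub_borel G) \<in> sets (Sub_borel G)"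
    using assms by (cases "A = {}") (auto intro!: sets.Int sets.finite_INT sets_member simp del: space_Sub_borel)
  moreover have "(\<Union>b\<in>B. {H. subgroup H G \<and> b \<in> H}) \<in> sets (Sub_borel G)"
    using assms by (auto intro!: sets.finite_UN sets_member)
  ultimately have "(\<Inter>a\<in>A. {H. subgroup H G \<and> a \<in> H}) \<inter> space (Sub_borel G) - (\<Union>b\<in>B. {H. subgroup H G \<and> b \<in> H})
      \<in> sets (Sub_borel G)" by (rule sets.Diff)
  also have "(\<Inter>a\<in>A. {H. subgroup H G \<and> a \<in> H}) \<inter> space (Sub_borel G) - (\<Union>b\<in>B. {H. subgroup H G \<and> b \<in> H})
      = cylinder A B"
    by (auto simp: cylinder_def)
  finally show ?thesis .
qed

text \<open>A pi-system argument: cylinders with only positive conditions are closed under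
  intersection, include the whole space (no condition), and generate the Borel sets.\<close>

lemma Sub_measure_eqI:
  assumes "prob_space \<mu>" "sets \<mu> = sets (Sub_borel G)" "sets \<mu>' = sets (Sub_borel G)"
    and eq: "\<And>A. finite A \<Longrightarrow> A \<subseteq> carrier G \<Longrightarrow> emeasure \<mu> (cylinder A {}) = emeasure \<mu>' (cylinder A {})"
  shows "\<mu> = \<mu>'"
proof -
  let ?S = "{H. subgroup H G}"
  define E where "E = {cylinder A {} | A. finite A \<and> A \<subseteq> carrier G}"
  have E_Pow: "E \<subseteq> Pow ?S" by (auto simp: E_def cylinder_def)
  have mem_E: "{H. subgroup H G \<and> g \<in> H} \<in> E" if "g \<in> carrier G" for g
    unfolding E_def using that by (auto intro!: exI[of _ "{g}"] simp: cylinder_def)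
  have "?S \<in> E" unfolding E_def by (auto intro!: exI[of _ "{}"] simp: cylinder_def)
  have gen: "sets (Sub_borel G) = sigma_sets ?S E"
  proof
    show "sigma_sets ?S E \<subseteq> sets (Sub_borel G)"
      using sets.sigma_sets_subset[of E "Sub_borel G"] by (auto simp: E_def intro: sets_cylinder)
    \<comment> \<open>The identity is measurable from the generated sigma-algebra to the Borel one
      by the elementwise criterion; this is the nontrivial inclusion.\<close>
    have "(\<lambda>H. H) \<in> measurable (sigma ?S E) (Sub_borel G)"
      by (rule measurable_SubI)
         (use mem_E in \<open>auto simp: space_measure_of[OF E_Pow] sets_measure_of[OF E_Pow]\<close>)
    then show "sets (Sub_borel G) \<subseteq> sigma_sets ?S E"
      using sets.sets_into_space[of _ "Sub_borel G"]
      by (auto simp: measurable_def space_measure_of[OF E_Pow] sets_measure_of[OF E_Pow] Int_absorb2)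
  qed
  have "Int_stable E"
  proof (rule Int_stableI)
    fix a b assume "a \<in> E" "b \<in> E"
    then obtain A B where "finite A" "A \<subseteq> carrier G" "a = cylinder A {}" "finite B" "B \<subseteq> carrier G" "b = cylinder B {}"
      by (auto simp: E_def)
    then show "a \<inter> b \<in> E" unfolding E_def by (auto intro!: exI[of _ "A \<union> B"] simp: cylinder_def)
  qed
  then show ?thesis
  proof (rule measure_eqI_generator_eq[where E = E and \<Omega> = ?S and A = "\<lambda>_. ?S"])
    interpret prob_space \<mu> by fact
    show "emeasure \<mu> ?S \<noteq> \<infinity>" for i :: nat by simp
  qed (use E_Pow eq gen assms \<open>?S \<in> E\<close> in \<open>auto simp: E_def\<close>)
qed

section \<open>Regularity of Borel probability measures on the space of subgroups\<close>

text \<open>An open cover comes from open sets of reals, and since every point of \<open>K\<close>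
  is the code of a subgroup, these sets cover \<open>K\<close> itself.\<close>

lemma compactin_code_vimage:
  assumes "compact K" "K \<subseteq> code ` {H. subgroup H G}"
  shows "compactin (Sub_topology G) {H. subgroup H G \<and> code H \<in> K}"
  unfolding compactin_def
proof (intro conjI allI impI)
  fix \<U> assume \<U>: "Ball \<U> (openin (Sub_topology G)) \<and> {H. subgroup H G \<and> code H \<in> K} \<subseteq> \<Union> \<U>"
  then have "\<forall>U\<in>\<U>. \<exists>V. open V \<and> U = {H. subgroup H G \<and> code H \<in> V}"
    using openin_Sub_topology_code by metis
  then obtain V where V: "\<And>U. U \<in> \<U> \<Longrightarrow> open (V U)" "\<And>U. U \<in> \<U> \<Longrightarrow> U = {H. subgroup H G \<and> code H \<in> V U}"
    by metis
  have "K \<subseteq> (\<Union>U\<in>\<U>. V U)"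
  proof
    fix x assume "x \<in> K"
    then obtain H where "subgroup H G" "x = code H" using assms(2) by auto
    with \<U> \<open>x \<in> K\<close> obtain U where "U \<in> \<U>" "H \<in> U" by blast
    with V(2)[of U] \<open>x = code H\<close> show "x \<in> (\<Union>U\<in>\<U>. V U)" by blast
  qed
  then obtain \<F> where "\<F> \<subseteq> \<U>" "finite \<F>" "K \<subseteq> (\<Union>U\<in>\<F>. V U)"
    using compactE_image[OF assms(1), of \<U> V] V(1) by blast
  moreover from this have "{H. subgroup H G \<and> code H \<in> K} \<subseteq> \<Union> \<F>"
    using V(2) by blast
  ultimately show "\<exists>\<F>. finite \<F> \<and> \<F> \<subseteq> \<U> \<and> {H. subgroup H G \<and> code H \<in> K} \<subseteq> \<Union> \<F>" by blast
qed auto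

lemma sets_decode_member [measurable]: "Measurable.pred borel (\<lambda>x. g \<in> decode x)"
proof (cases "g \<in> carrier G")
  case True
  then show ?thesis unfolding decode_def by simp
qed (auto simp: decode_def)

text \<open>Each subgroup axiom is a family of conditions on memberships indexed by the countable
  carrier.\<close>

lemma sets_subgroup_decode: "{x. subgroup (decode x) G} \<in> sets borel"
proof -
  have "{x. subgroup (decode x) G} = {x. (\<forall>g\<in>carrier G. \<forall>h\<in>carrier G. g \<in> decode x \<longrightarrow> h \<in> decode x \<longrightarrow> g \<otimes> h \<in> decode x)
      \<and> \<one> \<in> decode x \<and> (\<forall>g\<in>carrier G. g \<in> decode x \<longrightarrow> inv g \<in> decode x)}"
  proof (intro equalityI subsetI)
    fix x assume "x \<in> {x. (\<forall>g\<in>carrier G. \<forall>h\<in>carrier G. g \<in> decode x \<longrightarrow> h \<in> decode x \<longrightarrow> g \<otimes> h \<in> decode x)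
      \<and> \<one> \<in> decode x \<and> (\<forall>g\<in>carrier G. g \<in> decode x \<longrightarrow> inv g \<in> decode x)}"
    then show "x \<in> {x. subgroup (decode x) G}"
      unfolding mem_Collect_eq using decode_subset[of x] by (intro subgroupI) blast+
  qed (auto dest: subgroup.m_closed subgroup.one_closed subgroup.m_inv_closed)
  also have "\<dots> \<in> sets borel"
  proof -
    have mem: "{x \<in> space borel. g \<in> decode x} \<in> sets borel" for g
      using sets_decode_member[of g] by (simp add: pred_def)
    have ball: "{x \<in> space borel. \<forall>g\<in>carrier G. P g x} \<in> sets (borel :: real measure)"
      if "\<And>g. {x \<in> space borel. P g x} \<in> sets borel" for P
      using that by (auto simp: Collect_ball_eq intro!: sets.countable_INT'' countable_carrier)
    have "{x \<in> space borel. (\<forall>g\<in>carrier G. \<forall>h\<in>carrier G. g \<in> decode x \<longrightarrow> h \<in> decode x \<longrightarrow> g \<otimes> h \<in> decode x)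
      \<and> \<one> \<in> decode x \<and> (\<forall>g\<in>carrier G. g \<in> decode x \<longrightarrow> inv g \<in> decode x)} \<in> sets borel"
      by (intro sets.sets_Collect_conj ball sets.sets_Collect_imp mem)
    then show ?thesis by simp
  qed
  finally show ?thesis .
qed

text \<open>A total Borel left inverse of \<open>code\<close>. The default \<open>carrier G\<close>
  only has to be some subgroup; in the application it is used on a null set.\<close>

definition realize :: "real \<Rightarrow> 'a set" where
  "realize x = (if subgroup (decode x) G then decode x else carrier G)"

lemma measurable_realize [measurable]: "realize \<in> measurable borel (Sub_borel G)"
proof (rule measurable_SubI)
  fix g assume "g \<in> carrier G"
  have [measurable]: "Measurable.pred borel (\<lambda>x. subgroup (decode x) G)"
    using sets_subgroup_decode by (simp add: pred_def)
  have "{x \<in> space borel. g \<in> realize x} = {x \<in> space borel. (subgroup (decode x) G \<longrightarrow> g \<in> decode x)}"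
    using \<open>g \<in> carrier G\<close> by (auto simp: realize_def)
  also have "\<dots> \<in> sets borel" by measurable
  finally show "{x \<in> space borel. g \<in> realize x} \<in> sets borel" .
qed (auto simp: realize_def subgroup_self)

text \<open>A real codes a subgroup iff it decodes to one and is fixed by decoding and recoding;
  both conditions are Borel.\<close>

lemma sets_range_code: "code ` {H. subgroup H G} \<in> sets borel"
proof -
  have "code ` {H. subgroup H G} = {x. subgroup (decode x) G} \<inter> {x \<in> space borel. code (realize x) = x}"
  proof (intro equalityI subsetI)
    fix x assume "x \<in> {x. subgroup (decode x) G} \<inter> {x \<in> space borel. code (realize x) = x}"
    then show "x \<in> code ` {H. subgroup H G}"
      by (intro image_eqI[of _ _ "decode x"]) (auto simp: realize_def)
  qed (auto simp: realize_def decode_code[OF subgroup.subset])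
  also have "\<dots> \<in> sets borel"
    by (intro sets.Int sets_subgroup_decode borel_measurable_eq
        measurable_compose[OF measurable_realize measurable_code]) simp
  finally show ?thesis .
qed

text \<open>The image law under \<open>code\<close> is a finite Borel measure on the line, hence
  regular; compact and open sets are then pulled back.\<close>

lemma regular_measure_Sub:
  assumes "prob_space \<mu>" "sets \<mu> = sets (Sub_borel G)"
  shows "regular_measure (Sub_topology G) \<mu>"
  unfolding regular_measure_def
proof (intro ballI conjI)
  interpret prob_space \<mu> by fact
  let ?S = "{H. subgroup H G}"
  let ?D = "distr \<mu> borel code"
  have [measurable]: "code \<in> borel_measurable \<mu>"
    using measurable_code unfolding measurable_cong_sets[OF assms(2) refl] .
  have sp: "space \<mu> = ?S" using sets_eq_imp_space_eq[OF assms(2)] by simp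
  interpret D: prob_space ?D by (rule prob_space_distr) measurable
  have em: "emeasure ?D B = emeasure \<mu> {H. subgroup H G \<and> code H \<in> B}" if "B \<in> sets borel" for B
    using that by (subst emeasure_distr) (auto simp: sp intro!: arg_cong[where f = "emeasure \<mu>"])
  have vim: "{H. subgroup H G \<and> code H \<in> B} \<in> sets \<mu>" if "B \<in> sets borel" for B
    using that unfolding assms(2) sets_Sub_borel_code by (auto simp: vimage_def Int_def conj_commute)
  fix A assume A: "A \<in> sets \<mu>"
  then obtain B0 where B0: "B0 \<in> sets borel" "A = code -` B0 \<inter> ?S"
    unfolding assms(2) sets_Sub_borel_code by auto
  \<comment> \<open>Cutting down to the image of \<open>code\<close> leaves the preimage unchanged
    and puts every compact subset of \<open>B\<close> inside the image, as
    \<open>compactin_code_vimage\<close> requires.\<close>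
  define B where "B = B0 \<inter> code ` ?S"
  have B: "B \<in> sets borel" "A = {H. subgroup H G \<and> code H \<in> B}"
    using B0 sets_range_code by (auto simp: B_def)
  have emA: "emeasure \<mu> A = emeasure ?D B" using em[OF B(1)] B(2) by simp
  show "emeasure \<mu> A = (SUP K\<in>{K. compactin (Sub_topology G) K \<and> K \<in> sets \<mu> \<and> K \<subseteq> A}. emeasure \<mu> K)"
  proof (rule antisym)
    have "emeasure ?D B = (SUP K\<in>{K. K \<subseteq> B \<and> compact K}. emeasure ?D K)"
      by (rule inner_regular) (use B in auto)
    also have "\<dots> \<le> (SUP K\<in>{K. compactin (Sub_topology G) K \<and> K \<in> sets \<mu> \<and> K \<subseteq> A}. emeasure \<mu> K)"
    proof (rule SUP_least)
      fix K assume K: "K \<in> {K. K \<subseteq> B \<and> compact K}"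
      then have "K \<in> sets borel" by (auto intro: borel_compact)
      have "K \<subseteq> code ` ?S" "compact K" using K by (auto simp: B_def)
      then have "{H. subgroup H G \<and> code H \<in> K} \<in> {K. compactin (Sub_topology G) K \<and> K \<in> sets \<mu> \<and> K \<subseteq> A}"
        using K B(2) vim[OF \<open>K \<in> sets borel\<close>] compactin_code_vimage by blast
      then show "emeasure ?D K \<le> (SUP K\<in>{K. compactin (Sub_topology G) K \<and> K \<in> sets \<mu> \<and> K \<subseteq> A}. emeasure \<mu> K)"
        unfolding em[OF \<open>K \<in> sets borel\<close>]
        by (rule SUP_upper)
    qed
    finally show "emeasure \<mu> A \<le> (SUP K\<in>{K. compactin (Sub_topology G) K \<and> K \<in> sets \<mu> \<and> K \<subseteq> A}. emeasure \<mu> K)"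
      by (simp add: emA)
  qed (auto intro!: SUP_least emeasure_mono A)
  show "emeasure \<mu> A = (INF U\<in>{U. openin (Sub_topology G) U \<and> U \<in> sets \<mu> \<and> A \<subseteq> U}. emeasure \<mu> U)"
  proof (rule antisym)
    have "(INF U\<in>{U. openin (Sub_topology G) U \<and> U \<in> sets \<mu> \<and> A \<subseteq> U}. emeasure \<mu> U)
        \<le> (INF U\<in>{U. B \<subseteq> U \<and> open U}. emeasure ?D U)"
    proof (rule INF_greatest)
      fix U assume U: "U \<in> {U. B \<subseteq> U \<and> open U}"
      then have "U \<in> sets borel" by auto
      then have "{H. subgroup H G \<and> code H \<in> U} \<in> {U. openin (Sub_topology G) U \<and> U \<in> sets \<mu> \<and> A \<subseteq> U}"
        using U B(2) vim[OF \<open>U \<in> sets borel\<close>] openin_code_vimage by blast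
      then show "(INF U\<in>{U. openin (Sub_topology G) U \<and> U \<in> sets \<mu> \<and> A \<subseteq> U}. emeasure \<mu> U) \<le> emeasure ?D U"
        unfolding em[OF \<open>U \<in> sets borel\<close>]
        by (rule INF_lower)
    qed
    also have "\<dots> = emeasure ?D B"
      by (rule outer_regular[symmetric]) (use B in auto)
    finally show "(INF U\<in>{U. openin (Sub_topology G) U \<and> U \<in> sets \<mu> \<and> A \<subseteq> U}. emeasure \<mu> U) \<le> emeasure \<mu> A"
      by (simp add: emA)
  qed (auto intro!: INF_greatest emeasure_mono)
qed

end


section \<open>Limits of stabiliser distributions\<close>

text \<open>The empirical counterpart of the measure of \<open>cylinder A B\<close>. It makes sense
  even when the elements fixing a point do not form a subgroup.\<close>

definition fix_freq :: "nat \<Rightarrow> ('a \<Rightarrow> nat \<Rightarrow> nat) \<Rightarrow> 'a set \<Rightarrow> 'a set \<Rightarrow> real" where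
  "fix_freq n \<phi> A B = card {x \<in> {1..n}. (\<forall>a\<in>A. \<phi> a x = x) \<and> (\<forall>b\<in>B. \<phi> b x \<noteq> x)} / n"

lemma fix_freq_nonneg: "0 \<le> fix_freq n \<phi> A B"
  by (simp add: fix_freq_def)

lemma card_div_le:
  fixes S T :: "nat set"
  assumes "S \<subseteq> T" "finite T"
  shows "real (card S) / real n \<le> real (card T) / real n"
  using card_mono[OF assms(2,1)] by (simp add: divide_right_mono)

lemma asymptotic_hom_permutes:
  assumes "asymptotic_hom G n f" "a \<in> carrier G"
  shows "f l a permutes {1..n l}"
proof -
  have "f l a \<in> carrier (sym_group (n l))"
    using assms by (auto simp: asymptotic_hom_def)
  then show ?thesis by (simp only: sym_group_carrier)
qed

section \<open>Conjugation of subgroups\<close>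

context group
begin

lemma inv_cancel:
  assumes "x \<in> carrier G" "y \<in> carrier G"
  shows "inv x \<otimes> (x \<otimes> y) = y" "x \<otimes> (inv x \<otimes> y) = y"
  using assms by (simp_all flip: m_assoc)

lemma mem_conj_subgroup:
  assumes "subgroup H G" "g \<in> carrier G" "x \<in> carrier G"
  shows "x \<in> conj_subgroup G g H \<longleftrightarrow> inv g \<otimes> x \<otimes> g \<in> H"
proof
  assume "x \<in> conj_subgroup G g H"
  then obtain h where h: "h \<in> H" "x = g \<otimes> h \<otimes> inv g"
    by (auto simp: conj_subgroup_def l_coset_def r_coset_def)
  then have "h \<in> carrier G" using subgroup.subset[OF assms(1)] by auto
  then have "inv g \<otimes> x \<otimes> g = h"
    using assms(2) by (simp add: h(2) m_assoc inv_cancel)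
  with h show "inv g \<otimes> x \<otimes> g \<in> H" by simp
next
  assume "inv g \<otimes> x \<otimes> g \<in> H"
  moreover have "x = g \<otimes> (inv g \<otimes> x \<otimes> g) \<otimes> inv g"
    using assms(2,3) by (simp add: m_assoc inv_cancel)
  ultimately show "x \<in> conj_subgroup G g H"
    unfolding conj_subgroup_def l_coset_def r_coset_def by blast
qed

lemma conj_subgroup_subset:
  "subgroup H G \<Longrightarrow> g \<in> carrier G \<Longrightarrow> conj_subgroup G g H \<subseteq> carrier G"
  using subgroup.subset unfolding conj_subgroup_def l_coset_def r_coset_def by fastforce

lemma subgroup_conj_subgroup:
  assumes H: "subgroup H G" and g: "g \<in> carrier G"
  shows "subgroup (conj_subgroup G g H) G"
proof -
  interpret H: subgroup H G by fact
  note iff = mem_conj_subgroup[OF H g]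
  have sub: "conj_subgroup G g H \<subseteq> carrier G" by (rule conj_subgroup_subset[OF H g])
  show ?thesis
  proof (rule subgroupI[OF sub])
    have "\<one> \<in> conj_subgroup G g H" using g by (simp add: iff)
    then show "conj_subgroup G g H \<noteq> {}" by auto
  next
    fix a assume a: "a \<in> conj_subgroup G g H"
    then have ac: "a \<in> carrier G" using sub by auto
    have "inv (inv g \<otimes> a \<otimes> g) \<in> H" using a ac iff by simp
    also have "inv (inv g \<otimes> a \<otimes> g) = inv g \<otimes> inv a \<otimes> g"
      using ac g by (simp add: inv_mult_group m_assoc)
    finally show "inv a \<in> conj_subgroup G g H" using ac by (simp add: iff)
  next
    fix a b assume ab: "a \<in> conj_subgroup G g H" "b \<in> conj_subgroup G g H"
    then have c: "a \<in> carrier G" "b \<in> carrier G" using sub by auto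
    have "(inv g \<otimes> a \<otimes> g) \<otimes> (inv g \<otimes> b \<otimes> g) \<in> H" using ab c iff by simp
    also have "(inv g \<otimes> a \<otimes> g) \<otimes> (inv g \<otimes> b \<otimes> g) = inv g \<otimes> (a \<otimes> b) \<otimes> g"
      using c g by (simp add: m_assoc inv_cancel)
    finally show "a \<otimes> b \<in> conj_subgroup G g H" using c by (simp add: iff)
  qed
qed

end

section \<open>From almost multiplicative maps to an invariant random subgroup\<close>

context countable_group
begin

lemma measurable_conj_subgroup:
  assumes g: "g \<in> carrier G"
  shows "conj_subgroup G g \<in> measurable (Sub_borel G) (Sub_borel G)"
proof (rule measurable_SubI)
  fix x assume x: "x \<in> carrier G"
  have "{H \<in> space (Sub_borel G). x \<in> conj_subgroup G g H} = {H. subgroup H G \<and> inv g \<otimes> x \<otimes> g \<in> H}"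
    using mem_conj_subgroup[OF _ g x] by auto
  then show "{H \<in> space (Sub_borel G). x \<in> conj_subgroup G g H} \<in> sets (Sub_borel G)"
    using sets_member[of "inv g \<otimes> x \<otimes> g"] g x by simp
qed (use g subgroup_conj_subgroup in auto)

text \<open>A frequency is the integral of the bounded continuous function \<open>digit_test\<close>
  against the law of a code. One weakly convergent subsequence therefore gives convergence for all
  pairs \<open>A\<close>, \<open>B\<close> simultaneously.\<close>

lemma fix_freq_weak_limit:
  fixes n :: "nat \<Rightarrow> nat" and f :: "nat \<Rightarrow> 'a \<Rightarrow> nat \<Rightarrow> nat"
  assumes n: "\<And>l. n l \<ge> 1"
  obtains r M where "strict_mono r" "prob_space M" "sets M = sets (borel :: real measure)"
    "\<And>A B. finite A \<Longrightarrow> finite B \<Longrightarrow> A \<subseteq> carrier G \<Longrightarrow> B \<subseteq> carrier G \<Longrightarrow>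
      (\<lambda>l. fix_freq (n (r l)) (f (r l)) A B) \<longlonglongrightarrow> (\<integral>x. digit_test idx A B x \<partial>M)"
proof -
  define stab where "stab l x = {g \<in> carrier G. f l g x = x}" for l x
  define \<nu> where "\<nu> l = distr (measure_pmf (pmf_of_set {1..n l})) borel (\<lambda>x. code (stab l x))" for l
  have real_distr: "real_distribution (\<nu> l)" for l
    unfolding \<nu>_def real_distribution_def real_distribution_axioms_def
    by (auto intro!: measure_pmf.prob_space_distr)
  have int: "(\<integral>x. digit_test idx A B x \<partial>\<nu> l) = fix_freq (n l) (f l) A B"
    if AB: "finite A" "finite B" "A \<subseteq> carrier G" "B \<subseteq> carrier G" for l A B
  proof -
    have "(\<integral>x. digit_test idx A B x \<partial>\<nu> l)
        = (\<integral>x. digit_test idx A B (code (stab l x)) \<partial>measure_pmf (pmf_of_set {1..n l}))"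
      unfolding \<nu>_def by (rule integral_distr) auto
    also have "\<dots> = (\<integral>x. of_bool ((\<forall>a\<in>A. f l a x = x) \<and> (\<forall>b\<in>B. f l b x \<noteq> x)) \<partial>measure_pmf (pmf_of_set {1..n l}))"
    proof (rule Bochner_Integration.integral_cong[OF refl])
      fix x
      show "digit_test idx A B (code (stab l x)) = of_bool ((\<forall>a\<in>A. f l a x = x) \<and> (\<forall>b\<in>B. f l b x \<noteq> x))"
        by (rule digit_test_of_bool) (use AB in \<open>auto simp: stab_def digit_code subset_iff\<close>)
    qed
    also have "\<dots> = (\<Sum>x\<in>{1..n l}. of_bool ((\<forall>a\<in>A. f l a x = x) \<and> (\<forall>b\<in>B. f l b x \<noteq> x))) / card {1..n l}"
      using n[of l] by (subst integral_pmf_of_set) auto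
    also have "\<dots> = fix_freq (n l) (f l) A B"
      unfolding fix_freq_def by (simp add: Int_def)
    finally show ?thesis .
  qed
  have "tight \<nu>"
    unfolding tight_def
  proof (intro conjI allI impI)
    fix \<epsilon> :: real assume "\<epsilon> > 0"
    \<comment> \<open>All codes lie in [0, 3/2], so a single half-open interval carries full mass
      for every l and tightness is immediate.\<close>
    have "measure (\<nu> l) {-1<..2} = 1" for l
    proof -
      have "code (stab l x) \<in> {-1<..2}" for x
        using code_real_nonneg[of "idx ` stab l x"] code_real_le[of "idx ` stab l x"] by (auto simp: code_def)
      then have "(\<lambda>x. code (stab l x)) -` {-1<..2} = UNIV" by auto
      then show ?thesis
        unfolding \<nu>_def by (subst measure_distr) (auto simp: measure_pmf.prob_space[simplified])
    qed
    then show "\<exists>a b::real. a < b \<and> (\<forall>l. 1 - \<epsilon> < measure (\<nu> l) {a<..b})"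
      using \<open>\<epsilon> > 0\<close> by (intro exI[of _ "-1"] exI[of _ 2]) auto
  qed (rule real_distr)
  then obtain r M where r: "strict_mono r" "real_distribution M" "weak_conv_m (\<nu> \<circ> id \<circ> r) M"
    using tight_imp_convergent_subsubsequence[of \<nu> id] strict_mono_id by blast
  show ?thesis
  proof (rule that[OF r(1)])
    interpret M: real_distribution M by (rule r(2))
    show "prob_space M" by unfold_locales
    show "sets M = sets borel" by simp
    fix A B assume AB: "finite A" "finite B" "A \<subseteq> carrier G" "B \<subseteq> carrier G"
    have "(\<lambda>l. \<integral>x. digit_test idx A B x \<partial>((\<nu> \<circ> id \<circ> r) l)) \<longlonglongrightarrow> (\<integral>x. digit_test idx A B x \<partial>M)"
    proof (rule weak_conv_imp_integral_bdd_continuous_conv[OF _ r(2,3)])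
      show "norm (digit_test idx A B x) \<le> 1" for x
        using digit_test_bounds[of idx A B x] by simp
    qed (auto intro: isCont_digit_test real_distr)
    then show "(\<lambda>l. fix_freq (n (r l)) (f (r l)) A B) \<longlonglongrightarrow> (\<integral>x. digit_test idx A B x \<partial>M)"
      using int[OF AB] by (simp add: o_def)
  qed
qed

text \<open>Each pattern is a violation of a subgroup axiom by the set of elements fixing a point.
  Such a point must lie where one of at most two instances of multiplicativity fails.\<close>

lemma asymptotic_hom_fix_freq:
  assumes hom: "asymptotic_hom G n f" and g: "g \<in> carrier G" and h: "h \<in> carrier G"
  shows "(\<lambda>l. fix_freq (n l) (f l) {g, h} {g \<otimes> h}) \<longlonglongrightarrow> 0"
    and "(\<lambda>l. fix_freq (n l) (f l) {} {\<one>}) \<longlonglongrightarrow> 0"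
    and "(\<lambda>l. fix_freq (n l) (f l) {g} {inv g}) \<longlonglongrightarrow> 0"
proof -
  define bad where "bad l a b = {x \<in> {1..n l}. f l (a \<otimes> b) x \<noteq> (f l a \<circ> f l b) x}" for l a b
  have lim: "(\<lambda>l. card (bad l a b) / n l) \<longlonglongrightarrow> 0" if "a \<in> carrier G" "b \<in> carrier G" for a b
    using hom that unfolding asymptotic_hom_def perm_dist_def bad_def sym_group_mult by blast
  have fin: "finite (bad l a b)" for l a b by (simp add: bad_def)
  have perm: "f l a permutes {1..n l}" if "a \<in> carrier G" for l a
    by (rule asymptotic_hom_permutes[OF hom that])
  \<comment> \<open>If multiplicativity for the pair of units holds at x, injectivity of
    \<open>f l \<one>\<close> cancels one factor, so the unit fixes x.\<close>
  have one: "x \<in> bad l \<one> \<one>" if "x \<in> {1..n l}" "f l \<one> x \<noteq> x" for x l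
  proof (rule ccontr)
    assume "x \<notin> bad l \<one> \<one>"
    then have "f l \<one> x = f l \<one> (f l \<one> x)" using that(1) by (simp add: bad_def)
    then have "x = f l \<one> x" by (rule injD[OF permutes_inj[OF perm[OF one_closed]]])
    with that(2) show False by simp
  qed
  have sq: "(\<lambda>l. fix_freq (n l) (f l) A B) \<longlonglongrightarrow> 0"
    if "u \<longlonglongrightarrow> 0" "\<And>l. fix_freq (n l) (f l) A B \<le> u l" for u A B
    by (rule tendsto_sandwich[OF _ _ tendsto_const that(1)]) (auto simp: fix_freq_nonneg that(2))
  show "(\<lambda>l. fix_freq (n l) (f l) {g, h} {g \<otimes> h}) \<longlonglongrightarrow> 0"
    by (rule sq[OF lim[OF g h]], unfold fix_freq_def, rule card_div_le[OF _ fin]) (auto simp: bad_def)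
  show "(\<lambda>l. fix_freq (n l) (f l) {} {\<one>}) \<longlonglongrightarrow> 0"
    by (rule sq[OF lim[OF one_closed one_closed]], unfold fix_freq_def, rule card_div_le[OF _ fin])
       (use one in auto)
  have "(\<lambda>l. card (bad l (inv g) g) / n l + card (bad l \<one> \<one>) / n l) \<longlonglongrightarrow> 0 + 0"
    by (intro tendsto_add lim) (use g in auto)
  then have lim2: "(\<lambda>l. card (bad l (inv g) g) / n l + card (bad l \<one> \<one>) / n l) \<longlonglongrightarrow> 0"
    by simp
  show "(\<lambda>l. fix_freq (n l) (f l) {g} {inv g}) \<longlonglongrightarrow> 0"
  proof (rule sq[OF lim2])
    fix l
    \<comment> \<open>If both the unit and g fix x, then multiplicativity of \<open>inv g\<close>
      times g at x would make \<open>inv g\<close> fix x.\<close>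
    have "{x \<in> {1..n l}. (\<forall>a\<in>{g}. f l a x = x) \<and> (\<forall>b\<in>{inv g}. f l b x \<noteq> x)}
        \<subseteq> bad l (inv g) g \<union> bad l \<one> \<one>"
    proof
      fix x assume "x \<in> {x \<in> {1..n l}. (\<forall>a\<in>{g}. f l a x = x) \<and> (\<forall>b\<in>{inv g}. f l b x \<noteq> x)}"
      then have x: "x \<in> {1..n l}" "f l g x = x" "f l (inv g) x \<noteq> x" by auto
      show "x \<in> bad l (inv g) g \<union> bad l \<one> \<one>"
      proof (cases "f l \<one> x = x")
        case True
        then have "x \<in> bad l (inv g) g" using x g by (simp add: bad_def)
        then show ?thesis by simp
      qed (use one x(1) in simp)
    qed
    then have "fix_freq (n l) (f l) {g} {inv g} \<le> card (bad l (inv g) g \<union> bad l \<one> \<one>) / n l"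
      unfolding fix_freq_def by (rule card_div_le) (simp add: fin)
    also have "\<dots> \<le> (card (bad l (inv g) g) + card (bad l \<one> \<one>)) / n l"
      by (intro divide_right_mono) (use card_Un_le in \<open>auto simp flip: of_nat_add\<close>)
    finally show "fix_freq (n l) (f l) {g} {inv g} \<le> card (bad l (inv g) g) / n l + card (bad l \<one> \<one>) / n l"
      by (simp add: add_divide_distrib)
  qed
qed

text \<open>For an exact action, g carries the points fixed by \<open>F\<close> onto those fixed by
  its conjugate. Here this holds up to points where one of finitely many multiplicativity relations
  fails.\<close>

lemma asymptotic_hom_fix_freq_conj:
  assumes hom: "asymptotic_hom G n f" and g: "g \<in> carrier G" and F: "finite F" "F \<subseteq> carrier G"
  shows "(\<lambda>l. fix_freq (n l) (f l) ((\<lambda>h. g \<otimes> h \<otimes> inv g) ` F) {} - fix_freq (n l) (f l) F {}) \<longlonglongrightarrow> 0"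
proof -
  define bad where "bad l a b = {x \<in> {1..n l}. f l (a \<otimes> b) x \<noteq> (f l a \<circ> f l b) x}" for l a b
  have lim: "(\<lambda>l. card (bad l a b) / n l) \<longlonglongrightarrow> 0" if "a \<in> carrier G" "b \<in> carrier G" for a b
    using hom that unfolding asymptotic_hom_def perm_dist_def bad_def sym_group_mult by blast
  have fin: "finite (bad l a b)" for l a b by (simp add: bad_def)
  have perm: "f l a permutes {1..n l}" if "a \<in> carrier G" for l a
    by (rule asymptotic_hom_permutes[OF hom that])
  let ?c = "\<lambda>h. g \<otimes> h \<otimes> inv g"
  define u where "u l = (\<Sum>h\<in>F. card (bad l (?c h) g) / n l + card (bad l g h) / n l)" for l
  have "u \<longlonglongrightarrow> (\<Sum>h\<in>F. 0 + 0)"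
    unfolding u_def by (intro tendsto_sum tendsto_add lim) (use F g in auto)
  then have u: "u \<longlonglongrightarrow> 0" by simp
  have "\<bar>fix_freq (n l) (f l) (?c ` F) {} - fix_freq (n l) (f l) F {}\<bar> \<le> u l" for l
  proof -
    \<comment> \<open>The preimage under \<open>f l g\<close> of the points fixed by the conjugated
      set; it has the same cardinality and can be compared with \<open>S2\<close> pointwise.\<close>
    define S1 where "S1 = {y \<in> {1..n l}. \<forall>h\<in>F. f l (?c h) (f l g y) = f l g y}"
    define S2 where "S2 = {y \<in> {1..n l}. \<forall>h\<in>F. f l h y = y}"
    define B where "B = (\<Union>h\<in>F. bad l (?c h) g \<union> bad l g h)"
    have "finite B" "finite S1" "finite S2" by (auto simp: B_def fin F S1_def S2_def)
    have "f l g ` S1 = {x \<in> {1..n l}. \<forall>a\<in>?c ` F. f l a x = x}"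
    proof (intro equalityI subsetI)
      fix x assume x: "x \<in> {x \<in> {1..n l}. \<forall>a\<in>?c ` F. f l a x = x}"
      then obtain y where y: "y \<in> {1..n l}" "x = f l g y"
        using permutes_image[OF perm[OF g], of l] by (metis (lifting) imageE mem_Collect_eq)
      with x have "y \<in> S1" by (auto simp: S1_def)
      with y show "x \<in> f l g ` S1" by blast
    qed (use permutes_in_image[OF perm[OF g]] in \<open>auto simp: S1_def\<close>)
    moreover have "card (f l g ` S1) = card S1"
      by (rule card_image) (meson permutes_inj[OF perm[OF g]] inj_on_subset subset_UNIV)
    ultimately have c1: "fix_freq (n l) (f l) (?c ` F) {} = card S1 / n l"
      unfolding fix_freq_def by simp
    have c2: "fix_freq (n l) (f l) F {} = card S2 / n l"
      unfolding fix_freq_def S2_def by simp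
    have eq: "f l (?c h) (f l g y) = f l g y \<longleftrightarrow> f l h y = y"
      if "y \<in> {1..n l}" "y \<notin> B" "h \<in> F" for y h
    proof -
      have hc: "h \<in> carrier G" using that F by auto
      have "y \<notin> bad l (?c h) g" "y \<notin> bad l g h" using that by (auto simp: B_def)
      then have "f l (?c h) (f l g y) = f l (?c h \<otimes> g) y" "f l (g \<otimes> h) y = f l g (f l h y)"
        using that(1) by (auto simp: bad_def)
      \<comment> \<open>Comparing two factorisations of the same element avoids
        \<open>f l (inv g)\<close> altogether.\<close>
      moreover have "?c h \<otimes> g = g \<otimes> h" using g hc by (simp add: m_assoc)
      ultimately have "f l (?c h) (f l g y) = f l g (f l h y)" by simp
      then show ?thesis by (simp add: inj_eq[OF permutes_inj[OF perm[OF g]]])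
    qed
    have "card S1 \<le> card (S2 \<union> B)" "card S2 \<le> card (S1 \<union> B)"
      by (intro card_mono; use eq \<open>finite B\<close> \<open>finite S1\<close> \<open>finite S2\<close> in \<open>auto simp: S1_def S2_def\<close>)+
    then have "card S1 \<le> card S2 + card B" "card S2 \<le> card S1 + card B"
      using card_Un_le[of S2 B] card_Un_le[of S1 B] by linarith+
    then have "\<bar>real (card S1) - real (card S2)\<bar> \<le> real (card B)" by linarith
    also have "card B \<le> (\<Sum>h\<in>F. card (bad l (?c h) g) + card (bad l g h))"
      unfolding B_def by (rule order_trans[OF card_UN_le[OF F(1)]]) (intro sum_mono card_Un_le)
    finally have "\<bar>real (card S1) - real (card S2)\<bar> \<le> (\<Sum>h\<in>F. real (card (bad l (?c h) g)) + real (card (bad l g h)))"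
      by simp
    then have "\<bar>real (card S1) - real (card S2)\<bar> / n l \<le> (\<Sum>h\<in>F. real (card (bad l (?c h) g)) + real (card (bad l g h))) / n l"
      by (rule divide_right_mono) simp
    then show ?thesis
      unfolding c1 c2 u_def by (simp add: sum_divide_distrib add_divide_distrib flip: diff_divide_distrib)
  qed
  then show ?thesis by (intro Lim_null_comparison[OF _ u]) (auto intro: always_eventually)
qed

text \<open>The limit law on the line is concentrated on reals with honest 0-1 digits that decode to
  subgroups, so its image under \<open>realize\<close> keeps all cylinder values; asymptotic
  conjugation invariance of the frequencies passes to it.\<close>

lemma asymptotic_hom_limit_IRS:
  assumes hom: "asymptotic_hom G n f"
  obtains r \<mu> where "strict_mono r" "\<mu> \<in> IRS G"
    "\<And>A B. finite A \<Longrightarrow> finite B \<Longrightarrow> A \<subseteq> carrier G \<Longrightarrow> B \<subseteq> carrier G \<Longrightarrow>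
      (\<lambda>l. fix_freq (n (r l)) (f (r l)) A B) \<longlonglongrightarrow> measure \<mu> (cylinder A B)"
proof -
  have "\<And>l. n l \<ge> 1" using hom by (auto simp: asymptotic_hom_def)
  then obtain r M where r: "strict_mono r" and M: "prob_space M" "sets M = sets (borel :: real measure)"
    and lim: "\<And>A B. finite A \<Longrightarrow> finite B \<Longrightarrow> A \<subseteq> carrier G \<Longrightarrow> B \<subseteq> carrier G \<Longrightarrow>
      (\<lambda>l. fix_freq (n (r l)) (f (r l)) A B) \<longlonglongrightarrow> (\<integral>x. digit_test idx A B x \<partial>M)"
    using fix_freq_weak_limit[of n f] by blast
  interpret M: prob_space M by (rule M)
  have meas: "measurable M N = measurable borel N" for N :: "'c measure"
    using M(2) by (rule measurable_cong_sets) simp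
  have [measurable]: "digit_test idx A B \<in> borel_measurable M" for A B
    unfolding meas by measurable
  have null: "AE x in M. digit_test idx A B x = 0"
    if AB: "finite A" "finite B" "A \<subseteq> carrier G" "B \<subseteq> carrier G"
      and z: "(\<lambda>l. fix_freq (n l) (f l) A B) \<longlonglongrightarrow> 0" for A B
  proof -
    have "(\<integral>x. digit_test idx A B x \<partial>M) = 0"
      using LIMSEQ_unique[OF lim[OF AB] LIMSEQ_subseq_LIMSEQ[OF z r, unfolded o_def]] .
    moreover have "integrable M (digit_test idx A B)"
      by (rule M.integrable_const_bound[of _ 1]) (auto simp: digit_test_bounds)
    ultimately show ?thesis
      by (subst (asm) integral_nonneg_eq_0_iff_AE) (auto simp: digit_test_bounds)
  qed
  \<comment> \<open>This test is digit times (1 - digit), so its vanishing rules out fractional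
    digits. Its frequency is identically 0, as no point is both fixed and moved by g.\<close>
  have d: "AE x in M. \<forall>g\<in>carrier G. digit_test idx {g} {g} x = 0"
    by (intro AE_ball_countable[THEN iffD2] countable_carrier ballI null) (auto simp: fix_freq_def)
  have m: "AE x in M. \<forall>g\<in>carrier G. \<forall>h\<in>carrier G. digit_test idx {g, h} {g \<otimes> h} x = 0"
    by (intro AE_ball_countable[THEN iffD2] countable_carrier ballI null asymptotic_hom_fix_freq(1)[OF hom]) auto
  have o: "AE x in M. digit_test idx {} {\<one>} x = 0"
    by (intro null asymptotic_hom_fix_freq(2)[OF hom]) auto
  have i: "AE x in M. \<forall>g\<in>carrier G. digit_test idx {g} {inv g} x = 0"
    by (intro AE_ball_countable[THEN iffD2] countable_carrier ballI null asymptotic_hom_fix_freq(3)[OF hom]) auto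
  have good: "AE x in M. subgroup (decode x) G \<and> (\<forall>g\<in>carrier G. digit (idx g) x = of_bool (g \<in> decode x))"
    using d m o i
  proof eventually_elim
    case (elim x)
    have dig: "digit (idx g) x = of_bool (g \<in> decode x)" if "g \<in> carrier G" for g
      using elim(1) that by (auto simp: digit_test_def decode_def)
    have test: "\<not> ((\<forall>a\<in>A. a \<in> decode x) \<and> (\<forall>b\<in>B. b \<notin> decode x))"
      if "digit_test idx A B x = 0" "finite A" "finite B" "A \<subseteq> carrier G" "B \<subseteq> carrier G" for A B
      using that digit_test_of_bool[of A B idx x "\<lambda>g. g \<in> decode x"] dig by (auto simp: subset_iff)
    have "subgroup (decode x) G"
    proof (rule subgroupI[OF decode_subset])
      show "decode x \<noteq> {}" using test[OF elim(3)] by auto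
      show "inv a \<in> decode x" if "a \<in> decode x" for a
        using test[OF elim(4)[rule_format, of a]] that decode_subset[of x] by auto
      show "a \<otimes> b \<in> decode x" if "a \<in> decode x" "b \<in> decode x" for a b
        using test[OF elim(2)[rule_format, of a b]] that decode_subset[of x] by auto
    qed
    with dig show ?case by blast
  qed
  define \<mu> where "\<mu> = distr M (Sub_borel G) realize"
  have realize_M: "realize \<in> measurable M (Sub_borel G)"
    unfolding meas by (rule measurable_realize)
  have sets_\<mu>: "sets \<mu> = sets (Sub_borel G)" by (simp add: \<mu>_def)
  interpret \<mu>: prob_space \<mu> unfolding \<mu>_def by (rule M.prob_space_distr[OF realize_M])
  have meas_cyl: "measure \<mu> (cylinder A B) = (\<integral>x. digit_test idx A B x \<partial>M)"
    if AB: "finite A" "finite B" "A \<subseteq> carrier G" "B \<subseteq> carrier G" for A B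
  proof -
    note cyl = sets_cylinder[OF AB]
    have "measure \<mu> (cylinder A B) = measure M (realize -` cylinder A B \<inter> space M)"
      unfolding \<mu>_def by (rule measure_distr[OF realize_M cyl])
    also have "\<dots> = (\<integral>x. indicator (realize -` cylinder A B \<inter> space M) x \<partial>M)"
      using measurable_sets[OF realize_M cyl] by simp
    also have "\<dots> = (\<integral>x. digit_test idx A B x \<partial>M)"
    proof (rule integral_cong_AE)
      show "AE x in M. indicator (realize -` cylinder A B \<inter> space M) x = digit_test idx A B x"
        using good AE_space
      proof eventually_elim
        case (elim x)
        have "digit_test idx A B x = of_bool ((\<forall>a\<in>A. a \<in> decode x) \<and> (\<forall>b\<in>B. b \<notin> decode x))"
          by (rule digit_test_of_bool) (use AB elim in auto)
        then show ?case using elim by (auto simp: realize_def cylinder_def indicator_def)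
      qed
    qed (use measurable_sets[OF realize_M cyl] in auto)
    finally show ?thesis .
  qed
  have lim\<mu>: "(\<lambda>l. fix_freq (n (r l)) (f (r l)) A B) \<longlonglongrightarrow> measure \<mu> (cylinder A B)"
    if "finite A" "finite B" "A \<subseteq> carrier G" "B \<subseteq> carrier G" for A B
    using lim[OF that] meas_cyl[OF that] by simp
  \<comment> \<open>By \<open>Sub_measure_eqI\<close> only cylinders with positive conditions
    matter, and these are covered by \<open>asymptotic_hom_fix_freq_conj\<close>.\<close>
  have inv: "distr \<mu> (Sub_borel G) (conj_subgroup G g) = \<mu>" if g: "g \<in> carrier G" for g
  proof (rule sym, rule Sub_measure_eqI)
    have cm: "conj_subgroup G g \<in> measurable \<mu> (Sub_borel G)"
      unfolding measurable_cong_sets[OF sets_\<mu> refl] by (rule measurable_conj_subgroup[OF g])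
    fix A assume A: "finite A" "A \<subseteq> carrier G"
    \<comment> \<open>The preimage of a cylinder under conjugation by g conjugates its conditions by
      \<open>inv g\<close>. The double inverse is kept to match the conjugation lemma applied to
      \<open>inv g\<close>.\<close>
    let ?c = "\<lambda>h. inv g \<otimes> h \<otimes> inv (inv g)"
    have A': "finite (?c ` A)" "?c ` A \<subseteq> carrier G" using A g by auto
    have "conj_subgroup G g -` cylinder A {} \<inter> space \<mu> = cylinder (?c ` A) {}"
      using A g mem_conj_subgroup[OF _ g] subgroup_conj_subgroup[OF _ g] sets_eq_imp_space_eq[OF sets_\<mu>]
      by (auto simp: cylinder_def subset_iff image_iff)
    then have "emeasure (distr \<mu> (Sub_borel G) (conj_subgroup G g)) (cylinder A {}) = emeasure \<mu> (cylinder (?c ` A) {})"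
      using A by (subst emeasure_distr[OF cm]) (auto intro: sets_cylinder)
    moreover have "measure \<mu> (cylinder (?c ` A) {}) = measure \<mu> (cylinder A {})"
    proof -
      have "(\<lambda>l. fix_freq (n (r l)) (f (r l)) (?c ` A) {} - fix_freq (n (r l)) (f (r l)) A {}) \<longlonglongrightarrow> 0"
        using LIMSEQ_subseq_LIMSEQ[OF asymptotic_hom_fix_freq_conj[OF hom inv_closed[OF g] A] r]
        by (simp add: o_def)
      moreover have "(\<lambda>l. fix_freq (n (r l)) (f (r l)) (?c ` A) {} - fix_freq (n (r l)) (f (r l)) A {})
          \<longlonglongrightarrow> measure \<mu> (cylinder (?c ` A) {}) - measure \<mu> (cylinder A {})"
        by (intro tendsto_diff lim\<mu>) (use A A' in auto)
      ultimately show ?thesis using LIMSEQ_unique by fastforce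
    qed
    ultimately show "emeasure \<mu> (cylinder A {}) = emeasure (distr \<mu> (Sub_borel G) (conj_subgroup G g)) (cylinder A {})"
      by (simp add: \<mu>.emeasure_eq_measure)
  qed (auto simp: sets_\<mu> \<mu>.prob_space_axioms)
  have "\<mu> \<in> IRS G"
    unfolding IRS_def
    using \<mu>.prob_space_axioms sets_\<mu> regular_measure_Sub[OF \<mu>.prob_space_axioms sets_\<mu>] inv by blast
  from that[OF r this lim\<mu>] show ?thesis .
qed

end


section \<open>Finite-index subgroups and coset actions\<close>

lemma hom_generate_eqI:
  assumes "group G" "group K" "h \<in> hom G K" "h' \<in> hom G K" "S \<subseteq> carrier G"
    and eq: "\<And>s. s \<in> S \<Longrightarrow> h s = h' s" and "x \<in> generate G S"
  shows "h x = h' x"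
proof -
  interpret h: group_hom G K h using assms by (simp add: group_hom_def group_hom_axioms_def)
  interpret h': group_hom G K h' using assms by (simp add: group_hom_def group_hom_axioms_def)
  show ?thesis
    using assms(7)
  proof (induction rule: generate.induct)
    case (inv s)
    then show ?case using assms(5) eq[of s] by (simp add: subset_iff)
  next
    case (eng x y)
    then show ?case using h.G.generate_in_carrier[OF assms(5)] by simp
  qed (simp_all add: eq)
qed

text \<open>Every element is the value of a finite word in generators and their inverses, and there
  are countably many such words.\<close>

lemma finitely_generated_countable:
  assumes "finitely_generated_group G"
  shows "countable (carrier G)"
proof -
  from assms obtain S where G: "group G" and S: "finite S" "S \<subseteq> carrier G" "generate G S = carrier G"
    by (auto simp: finitely_generated_group_def)
  interpret group G by fact
  define T where "T = S \<union> m_inv G ` S"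
  define ev where "ev = (\<lambda>xs. foldr (\<otimes>\<^bsub>G\<^esub>) xs \<one>\<^bsub>G\<^esub>)"
  have T: "T \<subseteq> carrier G" using S(2) by (auto simp: T_def)
  have ev_closed: "ev xs \<in> carrier G" if "xs \<in> lists T" for xs
    using that T by (induction xs) (auto simp: ev_def)
  have ev_append: "ev (xs @ ys) = ev xs \<otimes>\<^bsub>G\<^esub> ev ys" if "xs \<in> lists T" "ys \<in> lists T" for xs ys
    using that(1)
  proof (induction xs)
    case Nil
    then show ?case using ev_closed[OF that(2)] by (simp add: ev_def)
  next
    case (Cons x xs)
    then have "ev ((x # xs) @ ys) = x \<otimes>\<^bsub>G\<^esub> (ev xs \<otimes>\<^bsub>G\<^esub> ev ys)" by (simp add: ev_def)
    also have "\<dots> = ev (x # xs) \<otimes>\<^bsub>G\<^esub> ev ys"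
      using Cons T ev_closed[of xs] ev_closed[OF that(2)] by (auto simp: ev_def m_assoc subset_iff)
    finally show ?case .
  qed
  have "x \<in> ev ` lists T" if "x \<in> generate G S" for x
    using that
  proof (induction rule: generate.induct)
    case one
    show ?case by (rule image_eqI[of _ _ "[]"]) (auto simp: ev_def)
  next
    case (incl s)
    then show ?case using S(2) by (intro image_eqI[of _ _ "[s]"]) (auto simp: ev_def T_def)
  next
    case (inv s)
    then show ?case using S(2) by (intro image_eqI[of _ _ "[inv\<^bsub>G\<^esub> s]"]) (auto simp: ev_def T_def)
  next
    case (eng x y)
    then obtain xs ys where "xs \<in> lists T" "ys \<in> lists T" "x = ev xs" "y = ev ys" by blast
    then show ?case by (intro image_eqI[of _ _ "xs @ ys"]) (auto simp: ev_append)
  qed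
  then have "carrier G \<subseteq> ev ` lists T" using S(3) by auto
  moreover have "countable (ev ` lists T)"
    using S(1) by (intro countable_image countable_lists) (auto simp: T_def countable_finite)
  ultimately show ?thesis by (rule countable_subset)
qed

context group
begin

lemma hom_sym_group_of_action:
  fixes act :: "'a \<Rightarrow> 'x \<Rightarrow> 'x"
  assumes X: "finite X" "card X = n"
    and closed: "\<And>g x. g \<in> carrier G \<Longrightarrow> x \<in> X \<Longrightarrow> act g x \<in> X"
    and one: "\<And>x. x \<in> X \<Longrightarrow> act \<one> x = x"
    and mult: "\<And>g h x. g \<in> carrier G \<Longrightarrow> h \<in> carrier G \<Longrightarrow> x \<in> X \<Longrightarrow> act (g \<otimes> h) x = act g (act h x)"
  obtains \<phi> e where "\<phi> \<in> hom G (sym_group n)" "bij_betw e X {1..n}"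
    "\<And>g x. g \<in> carrier G \<Longrightarrow> x \<in> X \<Longrightarrow> \<phi> g (e x) = e (act g x)"
proof -
  obtain e where e: "bij_betw e X {1..n}"
    using finite_same_card_bij[OF X(1), of "{1..n}"] X(2) by auto
  define d where "d = inv_into X e"
  have de: "d (e x) = x" if "x \<in> X" for x
    using that e by (simp add: d_def bij_betw_inv_into_left)
  have ed: "e (d i) = i" "d i \<in> X" if "i \<in> {1..n}" for i
    using that e bij_betw_inv_into_right[OF e that] bij_betwE[OF bij_betw_inv_into[OF e]] by (simp_all add: d_def)
  have eX: "e x \<in> {1..n}" if "x \<in> X" for x using that e by (rule bij_betw_apply[rotated])
  \<comment> \<open>Elements of \<open>sym_group n\<close> are permutations of all naturals that fix
    everything outside \<open>{1..n}\<close>, hence the second case.\<close>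
  define \<phi> where "\<phi> g i = (if i \<in> {1..n} then e (act g (d i)) else i)" for g i
  have \<phi>_mult: "\<phi> (g \<otimes> h) = \<phi> g \<circ> \<phi> h" if "g \<in> carrier G" "h \<in> carrier G" for g h
    using that closed mult de eX ed unfolding \<phi>_def by (intro ext) (auto simp del: atLeastAtMost_iff)
  have \<phi>_one: "\<phi> \<one> = id"
    using one ed unfolding \<phi>_def by (intro ext) (auto simp del: atLeastAtMost_iff)
  have \<phi>_perm: "\<phi> g permutes {1..n}" if g: "g \<in> carrier G" for g
  proof (rule bij_imp_permutes)
    have inv1: "\<phi> (inv g) (\<phi> g i) = i" and inv2: "\<phi> g (\<phi> (inv g) i) = i" for i
      using \<phi>_mult[of "inv g" g] \<phi>_mult[of g "inv g"] \<phi>_one g by (simp_all add: fun_eq_iff)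
    have mem: "\<phi> h i \<in> {1..n}" if "h \<in> carrier G" "i \<in> {1..n}" for h i
      using that closed eX ed by (simp add: \<phi>_def del: atLeastAtMost_iff)
    show "bij_betw (\<phi> g) {1..n} {1..n}"
      by (rule bij_betw_byWitness[where f' = "\<phi> (inv g)"]) (use inv1 inv2 mem g in \<open>auto simp del: atLeastAtMost_iff\<close>)
  qed (simp add: \<phi>_def del: atLeastAtMost_iff)
  show ?thesis
  proof (rule that[OF _ e])
    show "\<phi> \<in> hom G (sym_group n)"
      using \<phi>_perm \<phi>_mult by (intro homI) (simp_all add: sym_group_carrier sym_group_mult del: One_nat_def)
    show "\<phi> g (e x) = e (act g x)" if "g \<in> carrier G" "x \<in> X" for g x
      using that eX de by (simp add: \<phi>_def del: atLeastAtMost_iff)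
  qed
qed

section \<open>The action on right cosets and its point stabilisers\<close>

text \<open>On right cosets, right translation by the inverse gives a left action; this and the next
  two facts are its axioms.\<close>

lemma rcosets_act_closed: "subgroup H G \<Longrightarrow> g \<in> carrier G \<Longrightarrow> C \<in> rcosets H \<Longrightarrow> C #> inv g \<in> rcosets H"
  by (auto simp: RCOSETS_def coset_mult_assoc subgroup.subset)

lemma rcosets_act_one: "subgroup H G \<Longrightarrow> C \<in> rcosets H \<Longrightarrow> C #> inv \<one> = C"
  using subgroup.rcosets_carrier[OF _ is_group] by simp

lemma rcosets_act_mult:
  "subgroup H G \<Longrightarrow> g \<in> carrier G \<Longrightarrow> h \<in> carrier G \<Longrightarrow> C \<in> rcosets H \<Longrightarrow> C #> inv (g \<otimes> h) = C #> inv h #> inv g"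
  using subgroup.rcosets_carrier[OF _ is_group] by (simp add: coset_mult_assoc inv_mult_group)

definition coset_stab :: "'a set \<Rightarrow> 'a set" where
  "coset_stab C = {g \<in> carrier G. C #> inv g = C}"

lemma rcos_eq_iff:
  assumes "subgroup H G" "a \<in> carrier G" "b \<in> carrier G"
  shows "H #> a = H #> b \<longleftrightarrow> a \<otimes> inv b \<in> H"
  using assms repr_independence[of a H b] rcos_self[of a H] subgroup.rcos_module[of H G b a] is_group
  by auto

lemma coset_stab_rcos:
  assumes H: "subgroup H G" and a: "a \<in> carrier G"
  shows "coset_stab (H #> a) = conj_subgroup G (inv a) H"
proof -
  have "g \<in> coset_stab (H #> a) \<longleftrightarrow> g \<in> conj_subgroup G (inv a) H" if g: "g \<in> carrier G" for g
  proof -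
    have "H #> a #> inv g = H #> a \<longleftrightarrow> H #> a = H #> (a \<otimes> inv g)"
      using g a subgroup.subset[OF H] by (auto simp: coset_mult_assoc)
    also have "\<dots> \<longleftrightarrow> a \<otimes> g \<otimes> inv a \<in> H"
      using g a by (simp add: rcos_eq_iff[OF H] inv_mult_group m_assoc)
    finally show ?thesis
      using g a by (simp add: coset_stab_def mem_conj_subgroup[OF H])
  qed
  then show ?thesis
    using conj_subgroup_subset[OF H, of "inv a"] a by (auto simp: coset_stab_def)
qed

lemma conj_subgroup_conj_subgroup:
  assumes H: "subgroup H G" and g: "g \<in> carrier G" and h: "h \<in> carrier G"
  shows "conj_subgroup G g (conj_subgroup G h H) = conj_subgroup G (g \<otimes> h) H"
proof -
  note sub = subgroup_conj_subgroup[OF H]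
  have "x \<in> conj_subgroup G g (conj_subgroup G h H) \<longleftrightarrow> x \<in> conj_subgroup G (g \<otimes> h) H"
    if "x \<in> carrier G" for x
    using that g h by (simp add: mem_conj_subgroup H sub inv_mult_group m_assoc)
  then show ?thesis
    using conj_subgroup_subset[OF sub[OF h] g] conj_subgroup_subset[OF H, of "g \<otimes> h"] g h by auto
qed

lemma conj_subgroup_one: "subgroup H G \<Longrightarrow> conj_subgroup G \<one> H = H"
  using mem_conj_subgroup[of H \<one>] conj_subgroup_subset[of H \<one>] subgroup.subset[of H G]
  by (auto simp: subset_iff)

lemma conj_subgroup_inv_cancel:
  "subgroup H G \<Longrightarrow> g \<in> carrier G \<Longrightarrow> conj_subgroup G (inv g) (conj_subgroup G g H) = H"
  "subgroup H G \<Longrightarrow> g \<in> carrier G \<Longrightarrow> conj_subgroup G g (conj_subgroup G (inv g) H) = H"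
  by (simp_all add: conj_subgroup_conj_subgroup conj_subgroup_one)

text \<open>The identity behind it is \<open>(g H g^-1) b = g (H (g^-1 b))\<close>.\<close>

lemma rcosets_conj_subset:
  assumes H: "subgroup H G" and g: "g \<in> carrier G"
  shows "rcosets (conj_subgroup G g H) \<subseteq> (\<lambda>C. g <# C) ` (rcosets H)"
proof
  fix D assume "D \<in> rcosets (conj_subgroup G g H)"
  then obtain b where b: "b \<in> carrier G" "D = conj_subgroup G g H #> b" by (auto simp: RCOSETS_def)
  have "D = (g <# H) #> (inv g \<otimes> b)"
    using b g subgroup.subset[OF H] l_coset_subset_G[OF subgroup.subset[OF H] g]
    by (simp add: conj_subgroup_def coset_mult_assoc)
  also have "\<dots> = g <# (H #> (inv g \<otimes> b))"
    using b g subgroup.subset[OF H] by (simp add: coset_assoc)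
  finally show "D \<in> (\<lambda>C. g <# C) ` (rcosets H)"
    using b g subgroup.subset[OF H] by (auto intro: rcosetsI)
qed

text \<open>Conjugation cannot increase the index; conjugating back by the inverse gives the
  opposite inequality.\<close>

lemma finite_rcosets_conj:
  assumes H: "subgroup H G" and g: "g \<in> carrier G" and fin: "finite (rcosets H)"
  shows "finite (rcosets (conj_subgroup G g H))"
    and "card (rcosets (conj_subgroup G g H)) = card (rcosets H)"
proof -
  show fin': "finite (rcosets (conj_subgroup G g H))"
    using finite_subset[OF rcosets_conj_subset[OF H g]] fin by simp
  have "card (rcosets (conj_subgroup G g H)) \<le> card (rcosets H)"
    using surj_card_le[OF fin rcosets_conj_subset[OF H g]] .
  moreover have "card (rcosets (conj_subgroup G (inv g) (conj_subgroup G g H))) \<le> card (rcosets (conj_subgroup G g H))"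
    using surj_card_le[OF fin' rcosets_conj_subset[OF subgroup_conj_subgroup[OF H g] inv_closed[OF g]]] .
  ultimately show "card (rcosets (conj_subgroup G g H)) = card (rcosets H)"
    by (simp add: conj_subgroup_inv_cancel H g)
qed

text \<open>Inverting \<open>H a\<close> gives \<open>a^-1 H\<close>, which equals
  \<open>(a^-1 H a) a^-1\<close>, a right coset of the stabiliser of \<open>H a\<close>.\<close>

lemma m_inv_image_rcos:
  assumes H: "subgroup H G" and a: "a \<in> carrier G"
  shows "m_inv G ` (H #> a) = conj_subgroup G (inv a) H #> inv a"
proof -
  interpret H: subgroup H G by fact
  let ?K = "conj_subgroup G (inv a) H"
  have K: "subgroup ?K G" using subgroup_conj_subgroup[OF H] a by simp
  have "y \<in> m_inv G ` (H #> a) \<longleftrightarrow> y \<in> ?K #> inv a" if y: "y \<in> carrier G" for y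
  proof -
    have "y \<in> m_inv G ` (H #> a) \<longleftrightarrow> inv y \<in> H #> a"
      using y r_coset_subset_G[OF H.subset a] by (force simp: image_iff)
    also have "\<dots> \<longleftrightarrow> inv (a \<otimes> y) \<in> H"
      using y a H.rcos_module[OF is_group a inv_closed[OF y]] by (simp add: inv_mult_group)
    also have "\<dots> \<longleftrightarrow> a \<otimes> y \<in> H"
      using y a H.m_inv_closed[of "inv (a \<otimes> y)"] H.m_inv_closed[of "a \<otimes> y"] by auto
    also have "\<dots> \<longleftrightarrow> y \<otimes> a \<in> ?K"
      using y a by (simp add: mem_conj_subgroup[OF H] m_assoc)
    also have "\<dots> \<longleftrightarrow> y \<in> ?K #> inv a"
      using y a subgroup.rcos_module[OF K is_group, of "inv a" y] by simp
    finally show ?thesis .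
  qed
  moreover have "m_inv G ` (H #> a) \<subseteq> carrier G" "?K #> inv a \<subseteq> carrier G"
    using r_coset_subset_G[OF H.subset a] r_coset_subset_G[OF subgroup.subset[OF K]] a by auto
  ultimately show ?thesis by blast
qed

text \<open>A pair of a conjugate \<open>H\<close> of \<open>K\<close> and a right coset of \<open>H\<close> with stabiliser \<open>K\<close> is the same thing
  as a left coset of \<open>K\<close>; inversion turns the latter into a right coset.\<close>

lemma card_coset_stab_eq:
  assumes F: "finite F" "\<And>H. H \<in> F \<Longrightarrow> subgroup H G"
    "\<And>g H. g \<in> carrier G \<Longrightarrow> H \<in> F \<Longrightarrow> conj_subgroup G g H \<in> F"
    and K: "K \<in> F"
  shows "card (SIGMA H:F. {C \<in> rcosets H. coset_stab C = K}) = card (rcosets K)"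
proof (rule bij_betw_same_card)
  let ?f = "\<lambda>(H, C). m_inv G ` C"
  let ?P = "SIGMA H:F. {C \<in> rcosets H. coset_stab C = K}"
  have inj: "inj_on ?f ?P"
  proof (rule inj_onI, clarify)
    fix H C H' C' assume *: "H \<in> F" "C \<in> rcosets H" "H' \<in> F" "C' \<in> rcosets H'" "m_inv G ` C = m_inv G ` C'"
      "coset_stab C' = coset_stab C" "K = coset_stab C"
    have "C \<subseteq> carrier G" "C' \<subseteq> carrier G"
      using subgroup.rcosets_carrier[OF F(2)[OF *(1)] is_group *(2)]
        subgroup.rcosets_carrier[OF F(2)[OF *(3)] is_group *(4)] .
    moreover have "inj_on (m_inv G) (carrier G)" by (auto intro: inj_onI dest: inv_inj[THEN inj_onD])
    ultimately have C: "C = C'" using *(5) inj_on_image_eq_iff by metis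
    obtain a where a: "a \<in> carrier G" "C = H #> a" using *(2) by (auto simp: RCOSETS_def)
    have "a \<in> C'" using C a rcos_self F(2) *(1) by blast
    then obtain a' where a': "a' \<in> carrier G" "C' = H' #> a'" using *(4) by (auto simp: RCOSETS_def)
    \<comment> \<open>With a common representative, equal stabilisers become equal conjugates by the
      same element, which can be cancelled.\<close>
    have "C' = H' #> a" using repr_independence[OF _ a'(1)] \<open>a \<in> C'\<close> a'(2) F(2) *(3) by blast
    then have "conj_subgroup G (inv a) H = conj_subgroup G (inv a) H'"
      using *(6) a coset_stab_rcos F(2) *(1,3) by metis
    then have "H = H'" using conj_subgroup_inv_cancel(2)[OF F(2) a(1)] *(1,3) by metis
    with C show "H = H' \<and> C = C'" by simp
  qed
  have "?f ` ?P = rcosets K"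
  proof (intro equalityI subsetI)
    fix D assume "D \<in> ?f ` ?P"
    then obtain H C where HC: "H \<in> F" "C \<in> rcosets H" "coset_stab C = K" "D = m_inv G ` C" by auto
    then obtain a where a: "a \<in> carrier G" "C = H #> a" by (auto simp: RCOSETS_def)
    have "D = K #> inv a"
      using m_inv_image_rcos[OF F(2)[OF HC(1)] a(1)] HC a coset_stab_rcos[OF F(2)[OF HC(1)] a(1)] by simp
    then show "D \<in> rcosets K" using a F(2)[OF K] by (auto intro: rcosetsI dest: subgroup.subset)
  next
    fix D assume "D \<in> rcosets K"
    then obtain b where b: "b \<in> carrier G" "D = K #> b" by (auto simp: RCOSETS_def)
    \<comment> \<open>Forced choice: the coset of H through \<open>inv b\<close> has stabiliser
      \<open>b H b^-1\<close>, which must be \<open>K\<close>.\<close>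
    define H where "H = conj_subgroup G (inv b) K"
    have H: "H \<in> F" unfolding H_def using b K F(3) by simp
    have st: "conj_subgroup G b H = K"
      unfolding H_def using conj_subgroup_inv_cancel(2)[OF F(2)[OF K] b(1)] .
    have "coset_stab (H #> inv b) = K"
      using coset_stab_rcos[OF F(2)[OF H], of "inv b"] b st by simp
    moreover have "m_inv G ` (H #> inv b) = D"
      using m_inv_image_rcos[OF F(2)[OF H], of "inv b"] b st by simp
    moreover have "H #> inv b \<in> rcosets H"
      using b F(2)[OF H] by (auto intro: rcosetsI dest: subgroup.subset)
    ultimately show "D \<in> ?f ` ?P" using H by (intro image_eqI[of _ _ "(H, H #> inv b)"]) auto
  qed
  with inj show "bij_betw ?f ?P (rcosets K)" by (auto simp: bij_betw_def)
qed

text \<open>Choosing H with weight w and then a uniform coset of H returns the law w for the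
  stabiliser: w and the index are constant on conjugacy classes, and exactly
  \<open>card (rcosets K)\<close> pairs have stabiliser K.\<close>

lemma sum_coset_stab:
  fixes w :: "'a set \<Rightarrow> real"
  assumes F: "finite F" "\<And>H. H \<in> F \<Longrightarrow> subgroup H G" "\<And>H. H \<in> F \<Longrightarrow> finite (rcosets H)"
    "\<And>g H. g \<in> carrier G \<Longrightarrow> H \<in> F \<Longrightarrow> conj_subgroup G g H \<in> F"
    and w: "\<And>g H. g \<in> carrier G \<Longrightarrow> H \<in> F \<Longrightarrow> w (conj_subgroup G g H) = w H"
  shows "(\<Sum>H\<in>F. w H / card (rcosets H) * card {C \<in> rcosets H. coset_stab C \<in> E}) = sum w (F \<inter> E)"
proof -
  have stab: "coset_stab C \<in> F \<and> w (coset_stab C) = w H \<and> card (rcosets (coset_stab C)) = card (rcosets H)"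
    if "H \<in> F" "C \<in> rcosets H" for H C
    using that F w finite_rcosets_conj(2)[OF F(2) _ F(3)] by (auto simp: RCOSETS_def coset_stab_rcos)
  have "(\<Sum>H\<in>F. w H / card (rcosets H) * card {C \<in> rcosets H. coset_stab C \<in> E})
      = (\<Sum>H\<in>F. \<Sum>K\<in>F \<inter> E. w K / card (rcosets K) * card {C \<in> rcosets H. coset_stab C = K})"
  proof (rule sum.cong[OF refl])
    fix H assume H: "H \<in> F"
    have "{C \<in> rcosets H. coset_stab C \<in> E} = (\<Union>K\<in>F \<inter> E. {C \<in> rcosets H. coset_stab C = K})"
      using stab[OF H] by auto
    then have "card {C \<in> rcosets H. coset_stab C \<in> E} = (\<Sum>K\<in>F \<inter> E. card {C \<in> rcosets H. coset_stab C = K})"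
      using F(1) F(3)[OF H] by (simp, subst card_UN_disjoint) auto
    then have "w H / card (rcosets H) * card {C \<in> rcosets H. coset_stab C \<in> E}
        = (\<Sum>K\<in>F \<inter> E. w H / card (rcosets H) * card {C \<in> rcosets H. coset_stab C = K})"
      by (simp add: sum_distrib_left)
    \<comment> \<open>A nonempty fibre means that K is conjugate to H, so the weights agree; an
      empty fibre makes both terms zero.\<close>
    also have "\<dots> = (\<Sum>K\<in>F \<inter> E. w K / card (rcosets K) * card {C \<in> rcosets H. coset_stab C = K})"
    proof (rule sum.cong[OF refl])
      fix K
      show "w H / card (rcosets H) * card {C \<in> rcosets H. coset_stab C = K}
          = w K / card (rcosets K) * card {C \<in> rcosets H. coset_stab C = K}"
      proof (cases "{C \<in> rcosets H. coset_stab C = K} = {}")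
        case True
        then show ?thesis by (simp only: card.empty)
      next
        case False
        then show ?thesis using stab[OF H] by auto
      qed
    qed
    finally show "w H / card (rcosets H) * card {C \<in> rcosets H. coset_stab C \<in> E}
        = (\<Sum>K\<in>F \<inter> E. w K / card (rcosets K) * card {C \<in> rcosets H. coset_stab C = K})" .
  qed
  also have "\<dots> = (\<Sum>K\<in>F \<inter> E. w K / card (rcosets K) * (\<Sum>H\<in>F. card {C \<in> rcosets H. coset_stab C = K}))"
    by (subst sum.swap) (simp add: sum_distrib_left)
  also have "\<dots> = (\<Sum>K\<in>F \<inter> E. w K)"
  proof (rule sum.cong[OF refl])
    fix K assume "K \<in> F \<inter> E"
    then have K: "K \<in> F" by simp
    have "card (SIGMA H:F. {C \<in> rcosets H. coset_stab C = K}) = card (rcosets K)"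
      by (intro card_coset_stab_eq F K)
    then have "(\<Sum>H\<in>F. card {C \<in> rcosets H. coset_stab C = K}) = card (rcosets K)"
      using F(1,3) by simp
    moreover have "card (rcosets K) \<noteq> 0"
      using F(3)[OF K] rcosetsI[OF subgroup.subset[OF F(2)[OF K]] one_closed] by auto
    ultimately show "w K / card (rcosets K) * (\<Sum>H\<in>F. card {C \<in> rcosets H. coset_stab C = K}) = w K"
      by simp
  qed
  finally show ?thesis .
qed

text \<open>A subgroup of index m is a point stabiliser of a homomorphism to the symmetric group on
  m points, and such a homomorphism is determined by its values on the finite set of
  generators.\<close>

lemma finite_subgroups_bounded_index:
  assumes "finitely_generated_group G"
  shows "finite {H. subgroup H G \<and> finite (rcosets H) \<and> card (rcosets H) \<le> k}"
proof -
  from assms obtain S where S: "finite S" "S \<subseteq> carrier G" "generate G S = carrier G"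
    by (auto simp: finitely_generated_group_def)
  define F where "F = {H. subgroup H G \<and> finite (rcosets H) \<and> card (rcosets H) \<le> k}"
  have "\<exists>\<phi> i. \<phi> \<in> hom G (sym_group (card (rcosets H))) \<and> i \<in> {1..card (rcosets H)} \<and>
      H = {g \<in> carrier G. \<phi> g i = i}" if "H \<in> F" for H
  proof -
    from that have H: "subgroup H G" "finite (rcosets H)" by (auto simp: F_def)
    obtain \<phi> e where \<phi>: "\<phi> \<in> hom G (sym_group (card (rcosets H)))" and e: "bij_betw e (rcosets H) {1..card (rcosets H)}"
      and act: "\<And>g C. g \<in> carrier G \<Longrightarrow> C \<in> rcosets H \<Longrightarrow> \<phi> g (e C) = e (C #> inv g)"
      by (rule hom_sym_group_of_action[of "rcosets H" "card (rcosets H)" "\<lambda>g C. C #> inv g"])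
         (use H in \<open>auto simp: rcosets_act_closed rcosets_act_mult rcosets_act_one[simplified]\<close>)
    have HH: "H \<in> rcosets H" using rcosetsI[OF subgroup.subset[OF H(1)] one_closed] subgroup.subset[OF H(1)] by simp
    have "\<phi> g (e H) = e H \<longleftrightarrow> g \<in> H" if g: "g \<in> carrier G" for g
    proof -
      have "\<phi> g (e H) = e H \<longleftrightarrow> H #> inv g = H"
        unfolding act[OF g HH]
        by (rule inj_on_eq_iff[OF bij_betw_imp_inj_on[OF e] rcosets_act_closed[OF H(1) g HH] HH])
      also have "\<dots> \<longleftrightarrow> inv g \<in> H"
        using coset_join1[OF _ inv_closed[OF g] H(1)] coset_join2[OF inv_closed[OF g] H(1)] by auto
      also have "\<dots> \<longleftrightarrow> g \<in> H"
        using subgroup.m_inv_closed[OF H(1), of g] subgroup.m_inv_closed[OF H(1), of "inv g"] g by auto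
      finally show ?thesis .
    qed
    then have "H = {g \<in> carrier G. \<phi> g (e H) = e H}"
      using subgroup.subset[OF H(1)] by auto
    moreover have "e H \<in> {1..card (rcosets H)}" using e HH by (rule bij_betw_apply)
    ultimately show ?thesis using \<phi> by blast
  qed
  then have "\<forall>H\<in>F. \<exists>\<phi> i. \<phi> \<in> hom G (sym_group (card (rcosets H))) \<and> i \<in> {1..card (rcosets H)} \<and>
      H = {g \<in> carrier G. \<phi> g i = i}" by (rule ballI)
  from bchoice[OF this] obtain \<phi> where "\<forall>H\<in>F. \<exists>i. \<phi> H \<in> hom G (sym_group (card (rcosets H))) \<and>
      i \<in> {1..card (rcosets H)} \<and> H = {g \<in> carrier G. \<phi> H g i = i}" ..
  from bchoice[OF this] obtain i where i_all: "\<forall>H\<in>F. \<phi> H \<in> hom G (sym_group (card (rcosets H))) \<and>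
      i H \<in> {1..card (rcosets H)} \<and> H = {g \<in> carrier G. \<phi> H g (i H) = i H}" ..
  have \<phi>: "\<phi> H \<in> hom G (sym_group (card (rcosets H)))" and i: "i H \<in> {1..card (rcosets H)}"
    and H_eq: "{g \<in> carrier G. \<phi> H g (i H) = i H} = H" if "H \<in> F" for H
    using bspec[OF i_all that] by (blast, blast, simp)
  \<comment> \<open>Index, label of the base coset and generator images: enough data to recover H,
    ranging over a finite set.\<close>
  let ?code = "\<lambda>H. (card (rcosets H), i H, restrict (\<phi> H) S)"
  let ?T = "SIGMA m:{..k}. {1..m} \<times> (S \<rightarrow>\<^sub>E {p. p permutes {1..m}})"
  have "inj_on ?code F"
  proof (rule inj_onI)
    fix H H' assume H: "H \<in> F" "H' \<in> F" "?code H = ?code H'"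
    have "\<phi> H g = \<phi> H' g" if "g \<in> carrier G" for g
    proof (rule hom_generate_eqI[OF is_group sym_group_is_group \<phi>[OF H(1)] _ S(2)])
      show "\<phi> H' \<in> hom G (sym_group (card (rcosets H)))" using \<phi>[OF H(2)] H(3) by simp
      show "\<phi> H s = \<phi> H' s" if "s \<in> S" for s
        using H(3) that by (metis prod.inject restrict_apply')
    qed (use that S(3) in simp)
    then have "{g \<in> carrier G. \<phi> H g (i H) = i H} = {g \<in> carrier G. \<phi> H' g (i H') = i H'}"
      using H(3) by auto
    then show "H = H'" using H_eq[OF H(1)] H_eq[OF H(2)] by simp
  qed
  moreover have "?code ` F \<subseteq> ?T"
  proof (rule image_subsetI)
    fix H assume H: "H \<in> F"
    have "\<phi> H s permutes {1..card (rcosets H)}" if "s \<in> S" for s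
      using hom_in_carrier[OF \<phi>[OF H], of s] that S(2) sym_group_carrier by blast
    then show "?code H \<in> ?T" using H i[OF H] by (auto simp: F_def PiE_iff simp del: atLeastAtMost_iff)
  qed
  moreover have "finite ?T"
    using S(1) by (intro finite_SigmaI finite_cartesian_product finite_PiE finite_permutations) auto
  ultimately have "finite F" by (rule inj_on_finite)
  then show ?thesis by (simp only: F_def)
qed

end

section \<open>Realising prescribed frequencies by exact actions\<close>

lemma nat_floor_div_limit:
  fixes c :: real
  assumes "c \<ge> 0"
  shows "(\<lambda>n. nat \<lfloor>real n * c\<rfloor> / n) \<longlonglongrightarrow> c"
proof (rule tendsto_sandwich)
  show "\<forall>\<^sub>F n in sequentially. c - 1 / n \<le> nat \<lfloor>real n * c\<rfloor> / n"
    using eventually_gt_at_top[of 0]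
  proof eventually_elim
    case (elim n)
    have "real n * c - 1 \<le> nat \<lfloor>real n * c\<rfloor>" using assms by linarith
    then have "(real n * c - 1) / n \<le> nat \<lfloor>real n * c\<rfloor> / n" by (rule divide_right_mono) simp
    then show ?case using elim by (simp add: diff_divide_distrib)
  qed
  show "\<forall>\<^sub>F n in sequentially. nat \<lfloor>real n * c\<rfloor> / n \<le> c"
    using eventually_gt_at_top[of 0]
  proof eventually_elim
    case (elim n)
    have "nat \<lfloor>real n * c\<rfloor> \<le> real n * c" using assms by simp
    then have "nat \<lfloor>real n * c\<rfloor> / n \<le> real n * c / n" by (rule divide_right_mono) simp
    then show ?case using elim by simp
  qed
  have "(\<lambda>n. c - 1 / real n) \<longlonglongrightarrow> c - 0" by (intro tendsto_intros lim_1_over_n)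
  then show "(\<lambda>n. c - 1 / real n) \<longlonglongrightarrow> c" by simp
qed simp

context group
begin

text \<open>The action is the disjoint union of \<open>m H\<close> copies of the coset action for
  each H; the middle component of a point numbers the copies.\<close>

lemma hom_of_coset_multiplicities:
  fixes m :: "'a set \<Rightarrow> nat"
  assumes F: "finite F" "\<And>H. H \<in> F \<Longrightarrow> subgroup H G" "\<And>H. H \<in> F \<Longrightarrow> finite (rcosets H)"
    and n: "(\<Sum>H\<in>F. m H * card (rcosets H)) = n"
  shows "\<exists>\<phi>. \<phi> \<in> hom G (sym_group n) \<and> (\<forall>A B. A \<subseteq> carrier G \<longrightarrow> B \<subseteq> carrier G \<longrightarrow>
    fix_freq n \<phi> A B = (\<Sum>H\<in>F. m H / n * card {C \<in> rcosets H. coset_stab C \<in> {K. A \<subseteq> K \<and> B \<inter> K = {}}}))"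
proof -
  define X where "X = (SIGMA H:F. {..<m H} \<times> (rcosets H))"
  define act :: "'a \<Rightarrow> 'a set \<times> nat \<times> 'a set \<Rightarrow> 'a set \<times> nat \<times> 'a set"
    where "act g = (\<lambda>(H, i, C). (H, i, C #> inv g))" for g
  have "finite X" unfolding X_def using F by (intro finite_SigmaI finite_cartesian_product) auto
  moreover have "card X = n" unfolding X_def using F n by (simp add: card_cartesian_product)
  moreover have "act g x \<in> X" if "g \<in> carrier G" "x \<in> X" for g x
    using that F(2) by (auto simp: X_def act_def rcosets_act_closed)
  moreover have "act \<one> x = x" if "x \<in> X" for x
    using that F(2) rcosets_act_one by (auto simp: X_def act_def)
  moreover have "act (g \<otimes> h) x = act g (act h x)" if "g \<in> carrier G" "h \<in> carrier G" "x \<in> X" for g h x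
  proof -
    obtain H i C where "x = (H, i, C)" "H \<in> F" "C \<in> rcosets H" using \<open>x \<in> X\<close> by (auto simp: X_def)
    then show ?thesis using that rcosets_act_mult[OF F(2), of H g h C] by (simp add: act_def)
  qed
  ultimately obtain \<phi> e where \<phi>: "\<phi> \<in> hom G (sym_group n)" and e: "bij_betw e X {1..n}"
    and \<phi>_e: "\<And>g x. g \<in> carrier G \<Longrightarrow> x \<in> X \<Longrightarrow> \<phi> g (e x) = e (act g x)"
    by (rule hom_sym_group_of_action) blast+
  have fix_iff: "\<phi> g (e (H, i, C)) = e (H, i, C) \<longleftrightarrow> g \<in> coset_stab C" if "g \<in> carrier G" "(H, i, C) \<in> X" for g H i C
  proof -
    have "act g (H, i, C) \<in> X" using that F(2) by (auto simp: X_def act_def rcosets_act_closed)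
    then have "\<phi> g (e (H, i, C)) = e (H, i, C) \<longleftrightarrow> act g (H, i, C) = (H, i, C)"
      unfolding \<phi>_e[OF that] by (rule inj_on_eq_iff[OF bij_betw_imp_inj_on[OF e] _ that(2)])
    then show ?thesis using that by (simp add: act_def coset_stab_def)
  qed
  have "fix_freq n \<phi> A B = (\<Sum>H\<in>F. m H / n * card {C \<in> rcosets H. coset_stab C \<in> {K. A \<subseteq> K \<and> B \<inter> K = {}}})"
    if AB: "A \<subseteq> carrier G" "B \<subseteq> carrier G" for A B
  proof -
    let ?E = "{K. A \<subseteq> K \<and> B \<inter> K = {}}"
    let ?Y = "SIGMA H:F. {..<m H} \<times> {C \<in> rcosets H. coset_stab C \<in> ?E}"
    have YX: "?Y \<subseteq> X" by (auto simp: X_def)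
    have fix_E: "(\<forall>a\<in>A. \<phi> a (e x) = e x) \<and> (\<forall>b\<in>B. \<phi> b (e x) \<noteq> e x) \<longleftrightarrow> x \<in> ?Y" if "x \<in> X" for x
    proof -
      obtain H i C where x: "x = (H, i, C)" by (cases x)
      have "\<phi> a (e x) = e x \<longleftrightarrow> a \<in> coset_stab C" if "a \<in> A \<union> B" for a
        using fix_iff[of a H i C] that AB \<open>x \<in> X\<close> x by auto
      then have "(\<forall>a\<in>A. \<phi> a (e x) = e x) \<and> (\<forall>b\<in>B. \<phi> b (e x) \<noteq> e x) \<longleftrightarrow> coset_stab C \<in> ?E"
        by blast
      also have "\<dots> \<longleftrightarrow> x \<in> ?Y" using \<open>x \<in> X\<close> x by (simp add: X_def)
      finally show ?thesis .
    qed
    have "{y \<in> {1..n}. (\<forall>a\<in>A. \<phi> a y = y) \<and> (\<forall>b\<in>B. \<phi> b y \<noteq> y)} = e ` ?Y"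
    proof (intro equalityI subsetI)
      fix y assume y: "y \<in> {y \<in> {1..n}. (\<forall>a\<in>A. \<phi> a y = y) \<and> (\<forall>b\<in>B. \<phi> b y \<noteq> y)}"
      then have "y \<in> e ` X" using bij_betw_imp_surj_on[OF e] by simp
      then obtain x where x: "x \<in> X" "y = e x" by blast
      with y have "x \<in> ?Y" using fix_E[OF x(1)] by simp
      with x(2) show "y \<in> e ` ?Y" by blast
    next
      fix y assume "y \<in> e ` ?Y"
      then obtain x where x: "x \<in> ?Y" "y = e x" by blast
      then have "x \<in> X" using YX by blast
      then show "y \<in> {y \<in> {1..n}. (\<forall>a\<in>A. \<phi> a y = y) \<and> (\<forall>b\<in>B. \<phi> b y \<noteq> y)}"
        using fix_E[OF \<open>x \<in> X\<close>] x bij_betw_apply[OF e \<open>x \<in> X\<close>] by blast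
    qed
    moreover have "card (e ` ?Y) = card ?Y"
      by (rule card_image[OF inj_on_subset[OF bij_betw_imp_inj_on[OF e] YX]])
    moreover have "card ?Y = (\<Sum>H\<in>F. m H * card {C \<in> rcosets H. coset_stab C \<in> ?E})"
      using F by (subst card_SigmaI) (auto simp: card_cartesian_product)
    ultimately show ?thesis
      unfolding fix_freq_def by (simp add: sum_divide_distrib)
  qed
  with \<phi> show ?thesis by blast
qed

text \<open>The coset action of the whole group is a single fixed point, the unit with which any
  degree can be filled up exactly.\<close>

lemma subgroup_carrier_cosets: "rcosets (carrier G) = {carrier G}" "coset_stab (carrier G) = carrier G"
proof -
  have "carrier G #> a = carrier G" if "a \<in> carrier G" for a
    using that coset_join2 subgroup_self by blast
  then show "rcosets (carrier G) = {carrier G}" "coset_stab (carrier G) = carrier G"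
    unfolding RCOSETS_def coset_stab_def by auto
qed

text \<open>The mass not accounted for by \<open>w\<close> is realised by fixed points.\<close>

lemma homs_with_coset_frequencies:
  fixes w :: "'a set \<Rightarrow> real"
  assumes F: "finite F" "\<And>H. H \<in> F \<Longrightarrow> subgroup H G" "\<And>H. H \<in> F \<Longrightarrow> finite (rcosets H)"
    and w: "\<And>H. H \<in> F \<Longrightarrow> w H \<ge> 0" "sum w F \<le> 1"
    and c: "carrier G \<in> F"
  obtains \<phi> where "\<And>n. \<phi> n \<in> hom G (sym_group n)"
    "\<And>A B. A \<subseteq> carrier G \<Longrightarrow> B \<subseteq> carrier G \<Longrightarrow> (\<lambda>n. fix_freq n (\<phi> n) A B) \<longlonglongrightarrow>
      (\<Sum>H\<in>F. w H / card (rcosets H) * card {C \<in> rcosets H. coset_stab C \<in> {K. A \<subseteq> K \<and> B \<inter> K = {}}})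
      + (1 - sum w F) * of_bool (B = {})"
proof -
  define F' where "F' = F - {carrier G}"
  define x where "x H = card (rcosets H)" for H
  \<comment> \<open>Copies of a space of size \<open>x H\<close> that should cover a share
    \<open>w H\<close> of n points, rounded down so that the total never exceeds n.\<close>
  define m0 where "m0 n H = nat \<lfloor>real n * (w H / x H)\<rfloor>" for n H
  \<comment> \<open>Fixed points take all remaining places: the rounding loss, the share of
    \<open>carrier G\<close> itself, and the mass missing from w.\<close>
  define m where "m n H = (if H = carrier G then n - (\<Sum>H\<in>F'. m0 n H * x H) else m0 n H)" for n H
  have F': "finite F'" "\<And>H. H \<in> F' \<Longrightarrow> H \<in> F" "\<And>H. H \<in> F' \<Longrightarrow> H \<noteq> carrier G" using F(1) by (auto simp: F'_def)
  have split: "sum u F = u (carrier G) + sum u F'" for u :: "'a set \<Rightarrow> 'c::comm_monoid_add"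
    unfolding F'_def by (rule sum.remove[OF F(1) c])
  have xpos: "x H > 0" if "H \<in> F" for H
    unfolding x_def using F(3)[OF that] rcosetsI[OF subgroup.subset[OF F(2)[OF that]] one_closed]
    by (auto simp: card_gt_0_iff)
  have le: "(\<Sum>H\<in>F'. m0 n H * x H) \<le> n" for n
  proof -
    have "real (m0 n H * x H) \<le> real n * w H" if "H \<in> F'" for H
    proof -
      have "real (m0 n H) \<le> real n * (w H / x H)"
        unfolding m0_def using w(1)[OF F'(2)[OF that]] by (intro of_nat_floor) simp
      then have "real (m0 n H) * x H \<le> real n * (w H / x H) * x H" by (rule mult_right_mono) simp
      then show ?thesis using xpos[OF F'(2)[OF that]] by simp
    qed
    then have "(\<Sum>H\<in>F'. real (m0 n H * x H)) \<le> (\<Sum>H\<in>F'. real n * w H)" by (rule sum_mono)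
    also have "\<dots> = real n * sum w F'" by (simp add: sum_distrib_left)
    also have "\<dots> \<le> real n * 1" using w(2) w(1)[OF c] split[of w] by (intro mult_left_mono) auto
    finally have "real (\<Sum>H\<in>F'. m0 n H * x H) \<le> real n" by simp
    then show ?thesis by linarith
  qed
  have x1: "x (carrier G) = 1" by (simp add: x_def subgroup_carrier_cosets)
  have m_F': "m n H = m0 n H" if "H \<in> F'" for n H using F'(3)[OF that] by (simp add: m_def)
  have "(\<Sum>H\<in>F. m n H * card (rcosets H)) = n" for n
    using le[of n] unfolding x_def[symmetric] by (simp add: split m_F' x1) (simp add: m_def)
  then have "\<forall>n. \<exists>\<phi>. \<phi> \<in> hom G (sym_group n) \<and> (\<forall>A B. A \<subseteq> carrier G \<longrightarrow> B \<subseteq> carrier G \<longrightarrow>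
      fix_freq n \<phi> A B = (\<Sum>H\<in>F. m n H / n * card {C \<in> rcosets H. coset_stab C \<in> {K. A \<subseteq> K \<and> B \<inter> K = {}}}))"
    by (intro allI hom_of_coset_multiplicities F)
  from choice[OF this] obtain \<phi> where \<phi>_all: "\<forall>n. \<phi> n \<in> hom G (sym_group n) \<and> (\<forall>A B. A \<subseteq> carrier G \<longrightarrow> B \<subseteq> carrier G \<longrightarrow>
      fix_freq n (\<phi> n) A B = (\<Sum>H\<in>F. m n H / n * card {C \<in> rcosets H. coset_stab C \<in> {K. A \<subseteq> K \<and> B \<inter> K = {}}}))" ..
  have \<phi>: "\<phi> n \<in> hom G (sym_group n)" for n
    using \<phi>_all by (rule allE) (erule conjunct1)
  have freq: "fix_freq n (\<phi> n) A B = (\<Sum>H\<in>F. m n H / n * card {C \<in> rcosets H. coset_stab C \<in> {K. A \<subseteq> K \<and> B \<inter> K = {}}})"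
    if "A \<subseteq> carrier G" "B \<subseteq> carrier G" for n A B
    using \<phi>_all[THEN spec, of n, THEN conjunct2, rule_format, OF that] .
  have lim0: "(\<lambda>n. m n H / n) \<longlonglongrightarrow> w H / x H" if "H \<in> F'" for H
    unfolding m_F'[OF that] m0_def
    using w(1)[OF F'(2)[OF that]] by (intro nat_floor_div_limit) simp
  have limc: "(\<lambda>n. m n (carrier G) / n) \<longlonglongrightarrow> w (carrier G) + (1 - sum w F)"
  proof -
    have "(\<lambda>n. 1 - (\<Sum>H\<in>F'. m n H / n * x H)) \<longlonglongrightarrow> 1 - (\<Sum>H\<in>F'. w H / x H * x H)"
      by (intro tendsto_intros lim0)
    also have "(\<Sum>H\<in>F'. w H / x H * x H) = sum w F'"
      using xpos F'(2) by (intro sum.cong) auto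
    also have "1 - sum w F' = w (carrier G) + (1 - sum w F)" by (simp add: split)
    finally have "(\<lambda>n. 1 - (\<Sum>H\<in>F'. m n H / n * x H)) \<longlonglongrightarrow> w (carrier G) + (1 - sum w F)" .
    moreover have "\<forall>\<^sub>F n in sequentially. 1 - (\<Sum>H\<in>F'. m n H / n * x H) = m n (carrier G) / n"
      using eventually_gt_at_top[of 0]
    proof eventually_elim
      case (elim n)
      have "m n (carrier G) / n = (real n - (\<Sum>H\<in>F'. m n H * x H)) / n"
        using le[of n] by (simp add: m_F' m_def[of n "carrier G"])
      then show ?case using elim by (simp add: diff_divide_distrib sum_divide_distrib)
    qed
    ultimately show ?thesis by (rule Lim_transform_eventually)
  qed
  show ?thesis
  proof (rule that[OF \<phi>])
    fix A B assume AB: "A \<subseteq> carrier G" "B \<subseteq> carrier G"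
    let ?q = "\<lambda>H. card {C \<in> rcosets H. coset_stab C \<in> {K. A \<subseteq> K \<and> B \<inter> K = {}}}"
    \<comment> \<open>A point fixed by everything meets all positive conditions and violates any
      negative one.\<close>
    have "{C \<in> rcosets (carrier G). coset_stab C \<in> {K. A \<subseteq> K \<and> B \<inter> K = {}}} = (if B = {} then {carrier G} else {})"
      using AB by (auto simp: subgroup_carrier_cosets)
    then have qc: "?q (carrier G) = of_bool (B = {})" using AB by simp
    have split_q: "(\<Sum>H\<in>F. m n H / n * ?q H) = m n (carrier G) / n * ?q (carrier G) + (\<Sum>H\<in>F'. m n H / n * ?q H)" for n
      by (rule split)
    have "(\<lambda>n. \<Sum>H\<in>F. m n H / n * ?q H) \<longlonglongrightarrow>
        (w (carrier G) + (1 - sum w F)) * ?q (carrier G) + (\<Sum>H\<in>F'. w H / x H * ?q H)"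
      unfolding split_q by (intro tendsto_add tendsto_mult tendsto_sum tendsto_const limc lim0)
    also have "(w (carrier G) + (1 - sum w F)) * ?q (carrier G) + (\<Sum>H\<in>F'. w H / x H * ?q H)
      = (\<Sum>H\<in>F. w H / x H * ?q H) + (1 - sum w F) * of_bool (B = {})"
      unfolding split[of "\<lambda>H. w H / x H * ?q H"] qc x1 by (simp add: algebra_simps)
    finally show "(\<lambda>n. fix_freq n (\<phi> n) A B) \<longlonglongrightarrow>
      (\<Sum>H\<in>F. w H / card (rcosets H) * ?q H) + (1 - sum w F) * of_bool (B = {})"
      unfolding freq[OF AB] x_def .
  qed
qed

end

context countable_group
begin

lemma sets_singleton_subgroup:
  assumes "subgroup H G"
  shows "{H} \<in> sets (Sub_borel G)"
proof -
  have "H' = H" if "subgroup H' G" "code H' = code H" for H'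
  proof -
    have "H' = decode (code H')" by (rule decode_code[OF subgroup.subset[OF that(1)], symmetric])
    also have "\<dots> = decode (code H)" by (rule arg_cong[OF that(2)])
    also have "\<dots> = H" by (rule decode_code[OF subgroup.subset[OF assms]])
    finally show ?thesis .
  qed
  then have "{H} = code -` {code H} \<inter> {H. subgroup H G}" using assms by blast
  moreover have "{code H} \<in> sets borel" by simp
  ultimately show ?thesis unfolding sets_Sub_borel_code by blast
qed

lemma IRS_conj_singleton:
  assumes "\<mu> \<in> IRS G" "subgroup H G" "g \<in> carrier G"
  shows "measure \<mu> {conj_subgroup G g H} = measure \<mu> {H}"
proof -
  have sets: "sets \<mu> = sets (Sub_borel G)" and inv: "distr \<mu> (Sub_borel G) (conj_subgroup G g) = \<mu>"
    using assms by (auto simp: IRS_def)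
  have meas: "conj_subgroup G g \<in> measurable \<mu> (Sub_borel G)"
    unfolding measurable_cong_sets[OF sets refl] by (rule measurable_conj_subgroup[OF assms(3)])
  have "measure \<mu> {conj_subgroup G g H} = measure (distr \<mu> (Sub_borel G) (conj_subgroup G g)) {conj_subgroup G g H}"
    using inv by simp
  also have "\<dots> = measure \<mu> (conj_subgroup G g -` {conj_subgroup G g H} \<inter> space \<mu>)"
    by (rule measure_distr[OF meas sets_singleton_subgroup[OF subgroup_conj_subgroup[OF assms(2,3)]]])
  also have "conj_subgroup G g -` {conj_subgroup G g H} \<inter> space \<mu> = {H}"
  proof -
    have "H' = H" if "subgroup H' G" "conj_subgroup G g H' = conj_subgroup G g H" for H'
    proof -
      have "H' = conj_subgroup G (inv g) (conj_subgroup G g H')"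
        by (rule conj_subgroup_inv_cancel(1)[OF that(1) assms(3), symmetric])
      also have "\<dots> = conj_subgroup G (inv g) (conj_subgroup G g H)" by (rule arg_cong[OF that(2)])
      also have "\<dots> = H" by (rule conj_subgroup_inv_cancel(1)[OF assms(2,3)])
      finally show ?thesis .
    qed
    then show ?thesis unfolding sets_eq_imp_space_eq[OF sets] space_Sub_borel using assms(2) by blast
  qed
  finally show ?thesis .
qed

text \<open>Truncation to subgroups of index at most k loses mass less than \<delta>. The truncated
  part is reproduced in the limit by coset actions, and the lost mass is replaced by fixed
  points.\<close>

lemma finite_index_IRS_approx:
  assumes fg: "finitely_generated_group G" and \<mu>: "\<mu> \<in> IRS G"
    and fin: "AE H in \<mu>. finite (rcosets H)" and \<delta>: "\<delta> > 0"
  obtains \<phi> where "\<And>n. \<phi> n \<in> hom G (sym_group n)"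
    "\<And>A B. finite A \<Longrightarrow> finite B \<Longrightarrow> A \<subseteq> carrier G \<Longrightarrow> B \<subseteq> carrier G \<Longrightarrow>
      \<forall>\<^sub>F n in sequentially. \<bar>fix_freq n (\<phi> n) A B - measure \<mu> (cylinder A B)\<bar> < \<delta>"
proof -
  interpret prob_space \<mu> using \<mu> by (simp add: IRS_def)
  have sets: "sets \<mu> = sets (Sub_borel G)" using \<mu> by (simp add: IRS_def)
  have space: "space \<mu> = {H. subgroup H G}" using sets_eq_imp_space_eq[OF sets] by simp
  define L where "L k = {H. subgroup H G \<and> finite (rcosets H) \<and> card (rcosets H) \<le> k}" for k
  have finL: "finite (L k)" for k unfolding L_def by (rule finite_subgroups_bounded_index[OF fg])
  have single: "{H} \<in> sets \<mu>" if "subgroup H G" for H unfolding sets by (rule sets_singleton_subgroup[OF that])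
  have fin_sets: "S \<in> sets \<mu>" if "S \<subseteq> L k" for S k
  proof -
    have "(\<Union>H\<in>S. {H}) \<in> sets \<mu>"
      using that finite_subset[OF that finL] by (intro sets.finite_UN single) (auto simp: L_def)
    then show ?thesis by simp
  qed
  have "(\<lambda>k. measure \<mu> (L k)) \<longlonglongrightarrow> measure \<mu> (\<Union>k. L k)"
    by (rule finite_Lim_measure_incseq) (auto intro: fin_sets simp: incseq_def L_def)
  also have "measure \<mu> (\<Union>k. L k) = 1"
  proof (rule prob_eq_1[THEN iffD2])
    show "AE H in \<mu>. H \<in> (\<Union>k. L k)"
      using fin AE_space by eventually_elim (auto simp: L_def space)
  qed (auto intro: fin_sets)
  finally have "\<forall>\<^sub>F k in sequentially. 1 - \<delta> < measure \<mu> (L k)"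
    using \<delta> by (intro order_tendstoD(1)) auto
  \<comment> \<open>The bound \<open>k \<ge> 1\<close> puts the whole group among the chosen
    subgroups, so fixed points are available for filling.\<close>
  then obtain k where k: "1 - \<delta> < measure \<mu> (L k)" "k \<ge> 1"
    using eventually_happens[OF eventually_conj[OF _ eventually_ge_at_top[of 1]]] by force
  define F where "F = L k"
  define w where "w H = measure \<mu> {H}" for H
  have F: "finite F" "\<And>H. H \<in> F \<Longrightarrow> subgroup H G" "\<And>H. H \<in> F \<Longrightarrow> finite (rcosets H)"
    using finL by (auto simp: F_def L_def)
  have Fc: "conj_subgroup G g H \<in> F" if "g \<in> carrier G" "H \<in> F" for g H
    using that finite_rcosets_conj subgroup_conj_subgroup by (simp add: F_def L_def)
  have wc: "w (conj_subgroup G g H) = w H" if "g \<in> carrier G" "H \<in> F" for g H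
    unfolding w_def by (rule IRS_conj_singleton[OF \<mu> F(2)[OF that(2)] that(1)])
  have w_sum: "sum w S = measure \<mu> S" if "S \<subseteq> F" for S
  proof -
    have "measure \<mu> S = sum w S"
      unfolding w_def
      by (rule finite_measure_eq_sum_singleton) (use that F finite_subset single in blast)+
    then show ?thesis by simp
  qed
  have c: "carrier G \<in> F"
    using k(2) by (simp add: F_def L_def subgroup_carrier_cosets subgroup_self)
  have w: "\<And>H. H \<in> F \<Longrightarrow> w H \<ge> 0" "sum w F \<le> 1" by (simp_all add: w_def[abs_def]) (use w_sum[of F] in \<open>simp add: w_def\<close>)
  obtain \<phi> where \<phi>: "\<And>n. \<phi> n \<in> hom G (sym_group n)"
    and lim: "\<And>A B. A \<subseteq> carrier G \<Longrightarrow> B \<subseteq> carrier G \<Longrightarrow> (\<lambda>n. fix_freq n (\<phi> n) A B) \<longlonglongrightarrow>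
      (\<Sum>H\<in>F. w H / card (rcosets H) * card {C \<in> rcosets H. coset_stab C \<in> {K. A \<subseteq> K \<and> B \<inter> K = {}}})
      + (1 - sum w F) * of_bool (B = {})"
    using homs_with_coset_frequencies[OF F w c] by blast
  show ?thesis
  proof (rule that[OF \<phi>])
    fix A B assume AB: "finite A" "finite B" "A \<subseteq> carrier G" "B \<subseteq> carrier G"
    let ?E = "{K. A \<subseteq> K \<and> B \<inter> K = {}}" and ?cyl = "cylinder A B"
    let ?q = "of_bool (B = {}) :: real"
    have cyl: "?cyl \<in> sets \<mu>" unfolding sets by (rule sets_cylinder[OF AB])
    have FS: "F \<in> sets \<mu>" unfolding F_def by (rule fin_sets[OF order_refl])
    have "F \<inter> ?E = F \<inter> ?cyl" using F(2) by (auto simp: cylinder_def)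
    then have "(\<Sum>H\<in>F. w H / card (rcosets H) * card {C \<in> rcosets H. coset_stab C \<in> ?E}) = measure \<mu> (F \<inter> ?cyl)"
      using sum_coset_stab[of F w ?E] F Fc wc w_sum[of "F \<inter> ?cyl"] by simp
    then have lim': "(\<lambda>n. fix_freq n (\<phi> n) A B) \<longlonglongrightarrow> measure \<mu> (F \<inter> ?cyl) + (1 - measure \<mu> F) * ?q"
      using lim[OF AB(3,4)] w_sum[of F] by simp
    have "measure \<mu> ?cyl = measure \<mu> (F \<inter> ?cyl) + measure \<mu> (?cyl - F)"
    proof -
      have "F \<inter> ?cyl \<union> (?cyl - F) = ?cyl" by blast
      moreover have "measure \<mu> (F \<inter> ?cyl \<union> (?cyl - F)) = measure \<mu> (F \<inter> ?cyl) + measure \<mu> (?cyl - F)"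
        by (rule finite_measure_Union) (use cyl FS in auto)
      ultimately show ?thesis by simp
    qed
    moreover have "measure \<mu> (?cyl - F) \<le> measure \<mu> (space \<mu> - F)"
      using sets.sets_into_space[OF cyl] FS by (intro finite_measure_mono) auto
    moreover have "measure \<mu> (space \<mu> - F) = 1 - measure \<mu> F" using prob_compl[OF FS] .
    moreover have "1 - measure \<mu> F < \<delta>" using k(1) by (simp add: F_def)
    moreover have "0 \<le> measure \<mu> (?cyl - F)" "0 \<le> (1 - measure \<mu> F) * ?q" "(1 - measure \<mu> F) * ?q \<le> 1 - measure \<mu> F"
      by simp_all
    \<comment> \<open>The fixed points added and the cylinder mass lost both lie between 0 and the
      missing mass, so their difference is still below \<delta>.\<close>
    ultimately have "\<bar>(measure \<mu> (F \<inter> ?cyl) + (1 - measure \<mu> F) * ?q) - measure \<mu> ?cyl\<bar> < \<delta>"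
      by linarith
    moreover have "(\<lambda>n. \<bar>fix_freq n (\<phi> n) A B - measure \<mu> ?cyl\<bar>)
        \<longlonglongrightarrow> \<bar>(measure \<mu> (F \<inter> ?cyl) + (1 - measure \<mu> F) * ?q) - measure \<mu> ?cyl\<bar>"
      by (intro tendsto_intros lim')
    ultimately show "\<forall>\<^sub>F n in sequentially. \<bar>fix_freq n (\<phi> n) A B - measure \<mu> ?cyl\<bar> < \<delta>"
      by (rule order_tendstoD(2)[rotated])
  qed
qed

end


section \<open>Local statistics of asymptotic homomorphisms\<close>

text \<open>Prescribing the exact trace A on Q is the cylinder condition that A fixes the point and
  the rest of Q moves it.\<close>

lemma pmf_stab_dist:
  assumes "n \<ge> 1" "A \<subseteq> Q"
  shows "pmf (stab_dist n f Q) A = fix_freq n f A (Q - A)"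
proof -
  have "pmf (stab_dist n f Q) A = card ({1..n} \<inter> (\<lambda>x. {\<gamma> \<in> Q. f \<gamma> x = x}) -` {A}) / card {1..n}"
    unfolding stab_dist_def pmf_map using assms(1) by (subst measure_pmf_of_set) auto
  also have "{1..n} \<inter> (\<lambda>x. {\<gamma> \<in> Q. f \<gamma> x = x}) -` {A}
      = {x \<in> {1..n}. (\<forall>a\<in>A. f a x = x) \<and> (\<forall>b\<in>Q - A. f b x \<noteq> x)}"
    using assms(2) by auto
  finally show ?thesis by (simp add: fix_freq_def)
qed

lemma asymptotic_hom_subseq:
  assumes "asymptotic_hom G n f" "strict_mono (s :: nat \<Rightarrow> nat)"
  shows "asymptotic_hom G (\<lambda>l. n (s l)) (\<lambda>l. f (s l))"
proof -
  have parts: "\<forall>l. n l \<ge> 1" "filterlim n at_top sequentially" "\<forall>l. f l \<in> carrier G \<rightarrow> carrier (sym_group (n l))"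
    and mult: "\<forall>a\<in>carrier G. \<forall>b\<in>carrier G.
      (\<lambda>l. perm_dist (n l) (f l (a \<otimes>\<^bsub>G\<^esub> b)) (f l a \<otimes>\<^bsub>sym_group (n l)\<^esub> f l b)) \<longlonglongrightarrow> 0"
    using assms(1) unfolding asymptotic_hom_def by blast+
  show ?thesis
    unfolding asymptotic_hom_def
  proof (intro conjI allI ballI)
    show "n (s l) \<ge> 1" for l using parts(1) ..
    show "f (s l) \<in> carrier G \<rightarrow> carrier (sym_group (n (s l)))" for l using parts(3) ..
    show "filterlim (\<lambda>l. n (s l)) at_top sequentially"
      by (rule filterlim_compose[OF parts(2) filterlim_subseq[OF assms(2)]])
    fix a b assume "a \<in> carrier G" "b \<in> carrier G"
    then have "(\<lambda>l. perm_dist (n l) (f l (a \<otimes>\<^bsub>G\<^esub> b)) (f l a \<otimes>\<^bsub>sym_group (n l)\<^esub> f l b)) \<longlonglongrightarrow> 0"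
      using mult by blast
    from LIMSEQ_subseq_LIMSEQ[OF this assms(2)]
    show "(\<lambda>l. perm_dist (n (s l)) (f (s l) (a \<otimes>\<^bsub>G\<^esub> b)) (f (s l) a \<otimes>\<^bsub>sym_group (n (s l))\<^esub> f (s l) b)) \<longlonglongrightarrow> 0"
      by (simp only: o_def)
  qed
qed

lemma eventually_diagonal:
  fixes P :: "nat \<Rightarrow> nat \<Rightarrow> bool"
  assumes P: "\<And>j. \<forall>\<^sub>F l in sequentially. P j l"
  obtains J where "filterlim J at_top sequentially" "\<forall>\<^sub>F l in sequentially. P (J l) l"
proof
  define S where "S l = {j. j \<le> l \<and> (j = 0 \<or> P j l)}" for l
  define J where "J l = Max (S l)" for l
  have fin: "finite (S l)" and ne: "S l \<noteq> {}" for l by (auto simp: S_def)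
  have J_ge: "\<forall>\<^sub>F l in sequentially. c \<le> J l" for c
    using P[of c] eventually_ge_at_top[of c]
  proof eventually_elim
    case (elim l)
    then have "c \<in> S l" by (simp add: S_def)
    then show ?case unfolding J_def by (rule Max_ge[OF fin])
  qed
  then show "filterlim J at_top sequentially" by (simp add: filterlim_at_top)
  show "\<forall>\<^sub>F l in sequentially. P (J l) l"
    using J_ge[of 1]
  proof eventually_elim
    case (elim l)
    have "J l \<in> S l" unfolding J_def by (rule Max_in[OF fin ne])
    with elim show ?case by (auto simp: S_def)
  qed
qed

context countable_group
begin

text \<open>Cylinders are clopen: their indicators are finite products of continuous membership
  functions, hence admissible weak-* test functions.\<close>

lemma cylinder_weak_limit:
  assumes m: "\<And>k. m k \<in> IRS G" and lim: "limitin (IRS_topology G) m \<mu> sequentially"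
    and AB: "finite A" "finite B" "A \<subseteq> carrier G" "B \<subseteq> carrier G"
  shows "(\<lambda>k. measure (m k) (cylinder A B)) \<longlonglongrightarrow> measure \<mu> (cylinder A B)"
proof -
  let ?\<phi> = "\<lambda>H. (\<Prod>a\<in>A. of_bool (a \<in> H)) * (\<Prod>b\<in>B. 1 - of_bool (b \<in> H)) :: real"
  note lim' = lim[unfolded limitin_IRS_topology[OF m]]
  have "\<mu> \<in> IRS G" using lim' by (rule conjunct1)
  have conv: "(\<lambda>k. integral\<^sup>L (m k) \<phi>) \<longlonglongrightarrow> integral\<^sup>L \<mu> \<phi>"
    if "continuous_map (Sub_topology G) euclideanreal \<phi>" for \<phi>
    using lim'[THEN conjunct2] that by (elim allE impE) assumption+
  have "continuous_map (Sub_topology G) euclideanreal ?\<phi>"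
    using AB by (intro continuous_map_real_mult continuous_map_prod continuous_map_diff continuous_map_member) auto
  moreover have "integral\<^sup>L M ?\<phi> = measure M (cylinder A B)" if "M \<in> IRS G" for M
  proof -
    have sets: "sets M = sets (Sub_borel G)" using that by (simp add: IRS_def)
    note space = sets_eq_imp_space_eq[OF sets]
    have "integral\<^sup>L M ?\<phi> = integral\<^sup>L M (indicator (cylinder A B))"
    proof (rule Bochner_Integration.integral_cong[OF refl])
      fix H assume H: "H \<in> space M"
      have dig: "digit (idx a) (code H) = of_bool (a \<in> H)" if "a \<in> A \<union> B" for a
        using H AB that space by (intro digit_code subgroup.subset) auto
      then have "digit_test idx A B (code H) = of_bool ((\<forall>a\<in>A. a \<in> H) \<and> (\<forall>b\<in>B. b \<notin> H))"
        by (intro digit_test_of_bool AB)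
      moreover have "digit_test idx A B (code H) = ?\<phi> H"
        unfolding digit_test_def by (simp add: dig cong: prod.cong)
      ultimately show "?\<phi> H = indicator (cylinder A B) H"
        using H space by (auto simp: cylinder_def indicator_def)
    qed
    also have "\<dots> = measure M (cylinder A B)"
      using sets_cylinder[OF AB] sets.sets_into_space[OF sets_cylinder[OF AB]] by (simp add: space Int_absorb2)
    finally show ?thesis .
  qed
  ultimately show ?thesis using conv[of ?\<phi>] m \<open>\<mu> \<in> IRS G\<close> by simp
qed

text \<open>The error splits into thirds: from f to the limit \<mu>, from \<mu> to a finite-index
  approximant, and from there to its realisation. Finiteness of \<open>Pow Q\<close> handles all
  patterns at once, and one good index contradicts the choice of subsequence.\<close>

lemma asymptotic_hom_eventually_close:
  assumes fg: "finitely_generated_group G" and cosofic: "\<And>\<mu>. \<mu> \<in> IRS G \<Longrightarrow> co_sofic G \<mu>"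
    and hom: "asymptotic_hom G n f" and Q: "finite Q" "Q \<subseteq> carrier G" and \<delta>: "\<delta> > 0"
  shows "\<forall>\<^sub>F l in sequentially. \<exists>g\<in>hom G (sym_group (n l)).
    \<forall>A\<in>Pow Q. \<forall>B\<in>Pow Q. \<bar>fix_freq (n l) (f l) A B - fix_freq (n l) g A B\<bar> < \<delta>"
proof (rule ccontr)
  define close where "close l \<longleftrightarrow> (\<exists>g\<in>hom G (sym_group (n l)).
    \<forall>A\<in>Pow Q. \<forall>B\<in>Pow Q. \<bar>fix_freq (n l) (f l) A B - fix_freq (n l) g A B\<bar> < \<delta>)" for l
  assume "\<not> ?thesis"
  then have "\<not> eventually close sequentially" by (simp only: close_def[abs_def] not_False_eq_True)
  from not_eventually_sequentiallyD[OF this] obtain s :: "nat \<Rightarrow> nat" where s: "strict_mono s" "\<And>l. \<not> close (s l)"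
    by auto
  obtain r \<mu> where r: "strict_mono r" and \<mu>: "\<mu> \<in> IRS G"
    and f_lim: "\<And>A B. finite A \<Longrightarrow> finite B \<Longrightarrow> A \<subseteq> carrier G \<Longrightarrow> B \<subseteq> carrier G \<Longrightarrow>
      (\<lambda>l. fix_freq (n (s (r l))) (f (s (r l))) A B) \<longlonglongrightarrow> measure \<mu> (cylinder A B)"
    by (rule asymptotic_hom_limit_IRS[OF asymptotic_hom_subseq[OF hom s(1)]]) (rule that)
  obtain m where m: "\<And>k. m k \<in> IRS G" "\<And>k. AE H in m k. finite (rcosets H)"
    and m_lim: "limitin (IRS_topology G) m \<mu> sequentially"
    using cosofic[OF \<mu>] unfolding co_sofic_def by blast
  have Q_sub: "finite A \<and> A \<subseteq> carrier G" if "A \<in> Pow Q" for A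
    using that Q by (auto intro: finite_subset)
  have finPow: "finite (Pow Q)" using Q(1) by simp
  have \<delta>3: "\<delta> / 3 > 0" using \<delta> by simp
  have ev_tendsto: "\<forall>\<^sub>F l in sequentially. \<bar>u l - c\<bar> < \<delta> / 3" if "u \<longlonglongrightarrow> c" for u and c :: real
    using tendstoD[OF that \<delta>3] by (simp add: dist_real_def)
  have "\<forall>\<^sub>F k in sequentially. \<forall>A\<in>Pow Q. \<forall>B\<in>Pow Q.
      \<bar>measure (m k) (cylinder A B) - measure \<mu> (cylinder A B)\<bar> < \<delta> / 3"
    using Q_sub by (intro eventually_ball_finite[OF finPow] ballI ev_tendsto cylinder_weak_limit[OF m(1) m_lim]) auto
  then obtain k where k: "\<And>A B. A \<in> Pow Q \<Longrightarrow> B \<in> Pow Q \<Longrightarrow>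
      \<bar>measure (m k) (cylinder A B) - measure \<mu> (cylinder A B)\<bar> < \<delta> / 3"
    using eventually_happens'[OF sequentially_bot] by blast
  obtain \<phi> where \<phi>: "\<And>i. \<phi> i \<in> hom G (sym_group i)"
    and \<phi>_close: "\<And>A B. finite A \<Longrightarrow> finite B \<Longrightarrow> A \<subseteq> carrier G \<Longrightarrow> B \<subseteq> carrier G \<Longrightarrow>
      \<forall>\<^sub>F i in sequentially. \<bar>fix_freq i (\<phi> i) A B - measure (m k) (cylinder A B)\<bar> < \<delta> / 3"
    by (rule finite_index_IRS_approx[OF fg m(1)[of k] m(2)[of k] \<delta>3]) (rule that)
  \<comment> \<open>The realisations are indexed by degree, so they are evaluated at the degrees of
    the subsequence, which tend to infinity.\<close>
  have "filterlim (\<lambda>l. n (s (r l))) sequentially sequentially"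
  proof -
    have "filterlim n sequentially sequentially" using hom by (simp add: asymptotic_hom_def)
    then show ?thesis
      by (rule filterlim_compose[OF _ filterlim_compose[OF filterlim_subseq[OF s(1)] filterlim_subseq[OF r]]])
  qed
  moreover have "\<forall>\<^sub>F i in sequentially. \<forall>A\<in>Pow Q. \<forall>B\<in>Pow Q.
      \<bar>fix_freq i (\<phi> i) A B - measure (m k) (cylinder A B)\<bar> < \<delta> / 3"
    using Q_sub by (intro eventually_ball_finite[OF finPow] ballI \<phi>_close) auto
  ultimately have ev1: "\<forall>\<^sub>F l in sequentially. \<forall>A\<in>Pow Q. \<forall>B\<in>Pow Q.
      \<bar>fix_freq (n (s (r l))) (\<phi> (n (s (r l)))) A B - measure (m k) (cylinder A B)\<bar> < \<delta> / 3"
    by (rule eventually_compose_filterlim[rotated])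
  have ev2: "\<forall>\<^sub>F l in sequentially. \<forall>A\<in>Pow Q. \<forall>B\<in>Pow Q.
      \<bar>fix_freq (n (s (r l))) (f (s (r l))) A B - measure \<mu> (cylinder A B)\<bar> < \<delta> / 3"
    using Q_sub by (intro eventually_ball_finite[OF finPow] ballI ev_tendsto f_lim) auto
  obtain l where l: "\<And>A B. A \<in> Pow Q \<Longrightarrow> B \<in> Pow Q \<Longrightarrow>
      \<bar>fix_freq (n (s (r l))) (\<phi> (n (s (r l)))) A B - measure (m k) (cylinder A B)\<bar> < \<delta> / 3"
    "\<And>A B. A \<in> Pow Q \<Longrightarrow> B \<in> Pow Q \<Longrightarrow>
      \<bar>fix_freq (n (s (r l))) (f (s (r l))) A B - measure \<mu> (cylinder A B)\<bar> < \<delta> / 3"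
    using eventually_happens'[OF sequentially_bot eventually_conj[OF ev1 ev2]] by blast
  have "\<bar>fix_freq (n (s (r l))) (f (s (r l))) A B - fix_freq (n (s (r l))) (\<phi> (n (s (r l)))) A B\<bar> < \<delta>"
    if "A \<in> Pow Q" "B \<in> Pow Q" for A B
    using l(1)[OF that] l(2)[OF that] k[OF that] by linarith
  then have "close (s (r l))" unfolding close_def using \<phi> by blast
  with s(2) show False by blast
qed

text \<open>Closeness for one Q and \<delta> is upgraded to a single sequence by letting the finite
  set and the tolerance vary slowly with l, by \<open>eventually_diagonal\<close>.\<close>

lemma asymptotic_hom_close_homs:
  assumes fg: "finitely_generated_group G" and cosofic: "\<And>\<mu>. \<mu> \<in> IRS G \<Longrightarrow> co_sofic G \<mu>"
    and hom: "asymptotic_hom G n f"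
  shows "\<exists>g. (\<forall>l. g l \<in> hom G (sym_group (n l))) \<and>
    (\<forall>Q. finite Q \<and> Q \<subseteq> carrier G \<longrightarrow>
      (\<lambda>l. tv_dist (Pow Q) (stab_dist (n l) (f l) Q) (stab_dist (n l) (g l) Q)) \<longlonglongrightarrow> 0)"
proof -
  \<comment> \<open>An increasing exhaustion of the carrier by finite sets; every finite Q is
    eventually contained in \<open>R (J l)\<close>.\<close>
  define R where "R j = {a \<in> carrier G. idx a < j}" for j
  have R: "finite (R j)" "R j \<subseteq> carrier G" for j
  proof -
    have "inj_on idx (R j)"
      using inj_on_to_nat_on[OF countable_carrier] by (rule inj_on_subset) (auto simp: R_def)
    moreover have "idx ` R j \<subseteq> {..<j}" by (auto simp: R_def)
    ultimately show "finite (R j)" by (rule inj_on_finite) simp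
  qed (auto simp: R_def)
  define good where "good j l g \<longleftrightarrow> g \<in> hom G (sym_group (n l)) \<and> (\<forall>A\<in>Pow (R j). \<forall>B\<in>Pow (R j).
    \<bar>fix_freq (n l) (f l) A B - fix_freq (n l) g A B\<bar> < 1 / Suc j)" for j l g
  have "\<forall>\<^sub>F l in sequentially. \<exists>g. good j l g" for j
    using asymptotic_hom_eventually_close[OF fg cosofic hom R, of "1 / Suc j"]
    by (simp add: good_def Bex_def)
  then obtain J where J: "filterlim J at_top sequentially" "\<forall>\<^sub>F l in sequentially. \<exists>g. good (J l) l g"
    by (rule eventually_diagonal)
  define g where "g l = (if \<exists>g. good (J l) l g then SOME g. good (J l) l g else (\<lambda>_. id))" for l
  have g_good: "good (J l) l (g l)" if "\<exists>g. good (J l) l g" for l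
    using someI_ex[OF that] that by (simp add: g_def)
  have triv: "(\<lambda>_. id) \<in> hom G (sym_group k)" for k
    by (intro homI) (auto simp: sym_group_carrier sym_group_mult permutes_id)
  have g_hom: "g l \<in> hom G (sym_group (n l))" for l
    using g_good[of l] triv by (cases "\<exists>g. good (J l) l g") (auto simp: good_def g_def)
  have n1: "n l \<ge> 1" for l using hom by (simp add: asymptotic_hom_def)
  have "(\<lambda>l. tv_dist (Pow Q) (stab_dist (n l) (f l) Q) (stab_dist (n l) (g l) Q)) \<longlonglongrightarrow> 0"
    if Q: "finite Q" "Q \<subseteq> carrier G" for Q
  proof (rule Lim_null_comparison)
    have "(\<lambda>l. real (card (Pow Q)) * (1 / Suc (J l)) / 2) \<longlonglongrightarrow> real (card (Pow Q)) * 0 / 2"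
      using filterlim_compose[OF LIMSEQ_Suc[OF lim_1_over_n] J(1)] by (intro tendsto_intros) auto
    then show "(\<lambda>l. real (card (Pow Q)) * (1 / Suc (J l)) / 2) \<longlonglongrightarrow> 0" by simp
    have "\<forall>\<^sub>F l in sequentially. \<forall>a\<in>Q. idx a < J l"
      using J(1) unfolding filterlim_at_top
      by (intro eventually_ball_finite[OF Q(1)] ballI) (auto simp: Suc_le_eq dest: spec[of _ "Suc _"])
    with J(2) show "\<forall>\<^sub>F l in sequentially. norm (tv_dist (Pow Q) (stab_dist (n l) (f l) Q) (stab_dist (n l) (g l) Q))
        \<le> real (card (Pow Q)) * (1 / Suc (J l)) / 2"
    proof eventually_elim
      case (elim l)
      have QR: "Q \<subseteq> R (J l)" using elim(2) Q(2) by (auto simp: R_def)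
      have "\<bar>pmf (stab_dist (n l) (f l) Q) A - pmf (stab_dist (n l) (g l) Q) A\<bar> \<le> 1 / Suc (J l)"
        if "A \<in> Pow Q" for A
      proof -
        have "A \<in> Pow (R (J l))" "Q - A \<in> Pow (R (J l))" using that QR by auto
        then have "\<bar>fix_freq (n l) (f l) A (Q - A) - fix_freq (n l) (g l) A (Q - A)\<bar> < 1 / Suc (J l)"
          using g_good[OF elim(1)] unfolding good_def by blast
        then show ?thesis using that by (simp add: pmf_stab_dist[OF n1])
      qed
      then have "(\<Sum>A\<in>Pow Q. \<bar>pmf (stab_dist (n l) (f l) Q) A - pmf (stab_dist (n l) (g l) Q) A\<bar>)
          \<le> real (card (Pow Q)) * (1 / Suc (J l))"
        by (rule sum_bounded_above)
      moreover have "0 \<le> tv_dist (Pow Q) (stab_dist (n l) (f l) Q) (stab_dist (n l) (g l) Q)"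
        unfolding tv_dist_def by (simp add: sum_nonneg)
      ultimately show ?case
        unfolding real_norm_def tv_dist_def by (simp only: abs_of_nonneg) (intro divide_right_mono, auto)
    qed
  qed
  with g_hom show ?thesis by blast
qed

end

text \<open>The conclusion \<open>correctable \<nu> G n f\<close> is common to both notions; only
  the existence of statistically close actions separates them, and
  \<open>asymptotic_hom_close_homs\<close> supplies these.\<close>

lemma flexibly_BS_rigid_iff_stable:
  assumes fg: "finitely_generated_group G" and cosofic: "\<forall>\<mu>\<in>IRS G. co_sofic G \<mu>"
  shows "flexibly_BS_rigid \<nu> G \<longleftrightarrow> flexibly_stable \<nu> G"
proof
  interpret countable_group G
    using fg finitely_generated_countable[OF fg]
    by (simp add: countable_group_def countable_group_axioms_def finitely_generated_group_def)
  assume rigid: "flexibly_BS_rigid \<nu> G"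
  show "flexibly_stable \<nu> G"
    unfolding flexibly_stable_def
  proof (intro allI impI)
    fix n f assume hom: "asymptotic_hom G n f"
    show "correctable \<nu> G n f"
      using rigid hom asymptotic_hom_close_homs[OF fg cosofic[rule_format] hom]
      unfolding flexibly_BS_rigid_def by blast
  qed
qed (auto simp: flexibly_BS_rigid_def flexibly_stable_def)

theorem proposition1p28:
  fixes \<Gamma> :: "('a, 'b) monoid_scheme" and \<nu> :: "real \<Rightarrow> nat \<Rightarrow> enat"
  assumes "finitely_generated_group \<Gamma>"
    and "\<forall>n\<ge>1. mono_on {0<..} (\<lambda>\<epsilon>. \<nu> \<epsilon> n)"
    and "\<forall>\<mu>\<in>IRS \<Gamma>. co_sofic \<Gamma> \<mu>"
  shows "(BS_rigid \<Gamma> \<longleftrightarrow> stable \<Gamma>) \<and>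
    (flexibly_BS_rigid \<nu> \<Gamma> \<longleftrightarrow> flexibly_stable \<nu> \<Gamma>)"
  \<comment> \<open>Both equivalences are instances of the same lemma, the first with the zero
    function in place of \<nu>.\<close>
  unfolding BS_rigid_def stable_def
  using flexibly_BS_rigid_iff_stable[OF assms(1,3)] by blast

end
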